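(* Let $n\ge 3$ and let $\gamma_1,\gamma_2$ be smooth functions on an open interval $I$. If $$\left(\ddot\gamma_1\dot\gamma_2-\ddot\gamma_2\dot\gamma_1\right)\dot\gamma_2>0$$ on $I$, then $F:I\times U\to\mathbb{A}^{n+1}$ ($U\subset\mathbb{R}^{n-1}$ open), $$F(t,\vec u)=\left(\vec u,\ \frac{\|\vec u\|^2}{2}+\gamma_1(t),\ \gamma_2(t)\right),$$ is a convex affine hypersurface with a pointwise $SO(n-1)$ symmetry. Its affine normal is $$\xi=\mu\,e_n+\nu\,\partial_t,\qquad \partial_t=\frac{\partial F}{\partial t},$$ where $e_n$ is the $n$-th standard basis vector of $\mathbb{R}^{n+1}$ and $\mu,\nu$ are functions of $t$ determined, for an appropriate choice of sign, by $$\dot\mu=-\nu\,\frac{\ddot\gamma_1\dot\gamma_2-\ddot\gamma_2\dot\gamma_1}{\dot\gamma_2},\qquad \mu^{n+2}\dot\gamma_2^3=\pm\left(\ddot\gamma_1\dot\gamma_2-\ddot\gamma_2\dot\gamma_1\right).$$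
   Context: $\mathbb{A}^{n+1}$ is $\mathbb{R}^{n+1}$ with its flat connection $D$ and the determinant as volume form. For an immersed hypersurface with transversal vector field $\xi$ write $D_XY=\nabla_XY+h(X,Y)\xi$, $D_X\xi=-SX+\tau(X)\xi$, and $\omega(X_1,\dots,X_n)=\det(X_1,\dots,X_n,\xi)$. If $h$ is non-degenerate, the affine normal is the transversal field $\xi$, unique up to sign, with $\nabla\omega=0$ (equivalently $\tau=0$) and $\omega(X_1,\dots,X_n)^2=|\det(h(X_i,X_j))|$ for tangent frames. The hypersurface is convex (strictly locally convex) when $h$ is definite, and the sign of $\xi$ is then chosen so that $h$ is positive definite. With this $\xi$, $h$ is the affine metric, $S$ the shape operator, $\nabla$ the Blaschke connection, $\hat\nabla$ the Levi-Civita connection of $h$, and $K(X,Y)=\nabla_XY-\hat\nabla_XY$ the difference tensor. Pointwise $SO(n-1)$ symmetry: at every point $p$ there is an $h$-unit tangent vector $X_1$ such that every linear automorphism $g$ of the tangent space at $p$ with $gX_1=X_1$ which restricts to an element of $SO(\langle X_1\rangle^\perp)$ satisfies $S(gX)=gS(X)$ and $K(gX,gY)=gK(X,Y)$ for all tangent $X,Y$. Dots denote derivatives with respect to $t$. *)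

theory Defs
  imports "HOL-Analysis.Analysis"
begin

subsection \<open>Smooth maps\<close>

primrec k_times_diff_on :: "nat \<Rightarrow> 'a::real_normed_vector set \<Rightarrow> ('a \<Rightarrow> 'b::real_normed_vector) \<Rightarrow> bool" where
  "k_times_diff_on 0 M f \<longleftrightarrow> continuous_on M f"
| "k_times_diff_on (Suc k) M f \<longleftrightarrow>
     (\<forall>x\<in>M. f differentiable (at x)) \<and>
     (\<forall>v. k_times_diff_on k M (\<lambda>x. frechet_derivative f (at x) v))"

text \<open>Meant for open \<open>M\<close>: class \<open>C\<close>-infinity, all iterated directional derivatives exist and are
  continuous.\<close>

definition smooth_on :: "'a::real_normed_vector set \<Rightarrow> ('a \<Rightarrow> 'b::real_normed_vector) \<Rightarrow> bool" where
  "smooth_on M f \<longleftrightarrow> (\<forall>k. k_times_diff_on k M f)"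


subsection \<open>Hypersurfaces with a transversal field\<close>

text \<open>A hypersurface is an immersion \<open>F\<close> of an open subset \<open>M\<close> of an \<open>n\<close>-dimensional Euclidean space
  \<open>'a\<close>. The ambient affine space has coordinates indexed by \<open>'n option\<close> with \<open>CARD('n) = n\<close>;
  \<open>None\<close> is the last one. Tangent vectors at every point of \<open>M\<close> are identified with elements of
  \<open>'a\<close>, so vector fields are maps \<open>'a \<Rightarrow> 'a\<close> and transversal fields (vector fields along \<open>F\<close>) are maps
  \<open>'a \<Rightarrow> real^('n option)\<close>. Only their values on \<open>M\<close> matter.\<close>

definition immersed_hypersurface ::
  "'a::euclidean_space set \<Rightarrow> ('a \<Rightarrow> real^('n::finite option)) \<Rightarrow> bool" where
  "immersed_hypersurface M F \<longleftrightarrow>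
     DIM('a) = CARD('n) \<and> open M \<and> smooth_on M F \<and>
     (\<forall>x\<in>M. inj (frechet_derivative F (at x)))"

definition transversal_field ::
  "'a::euclidean_space set \<Rightarrow> ('a \<Rightarrow> real^('n::finite option)) \<Rightarrow> ('a \<Rightarrow> real^('n option)) \<Rightarrow> bool" where
  "transversal_field M F \<xi> \<longleftrightarrow>
     smooth_on M \<xi> \<and> (\<forall>x\<in>M. \<xi> x \<notin> range (frechet_derivative F (at x)))"

text \<open>The components of \<open>z\<close> in the decomposition \<open>z = dF v + c \<xi>\<close> at the point \<open>x\<close>.\<close>

definition tangential_part ::
  "('a::euclidean_space \<Rightarrow> real^('n::finite option)) \<Rightarrow> ('a \<Rightarrow> real^('n option)) \<Rightarrow> 'a \<Rightarrow>
   real^('n option) \<Rightarrow> 'a" where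
  "tangential_part F \<xi> x z = (THE v. \<exists>c. z = frechet_derivative F (at x) v + c *\<^sub>R \<xi> x)"

definition transversal_part ::
  "('a::euclidean_space \<Rightarrow> real^('n::finite option)) \<Rightarrow> ('a \<Rightarrow> real^('n option)) \<Rightarrow> 'a \<Rightarrow>
   real^('n option) \<Rightarrow> real" where
  "transversal_part F \<xi> x z = (THE c. \<exists>v. z = frechet_derivative F (at x) v + c *\<^sub>R \<xi> x)"

text \<open>\<open>D_X (dF Y)\<close> for the flat connection of the ambient space.\<close>

definition flat_deriv ::
  "('a::euclidean_space \<Rightarrow> real^('n::finite option)) \<Rightarrow> ('a \<Rightarrow> 'a) \<Rightarrow> ('a \<Rightarrow> 'a) \<Rightarrow> 'a \<Rightarrow>
   real^('n option)" where
  "flat_deriv F X Y x =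
     frechet_derivative (\<lambda>y. frechet_derivative F (at y) (Y y)) (at x) (X x)"

text \<open>Gauss formula \<open>D_X (dF Y) = dF (\<nabla>_X Y) + h(X,Y) \<xi>\<close>.\<close>

definition induced_conn ::
  "('a::euclidean_space \<Rightarrow> real^('n::finite option)) \<Rightarrow> ('a \<Rightarrow> real^('n option)) \<Rightarrow>
   ('a \<Rightarrow> 'a) \<Rightarrow> ('a \<Rightarrow> 'a) \<Rightarrow> 'a \<Rightarrow> 'a" where
  "induced_conn F \<xi> X Y x = tangential_part F \<xi> x (flat_deriv F X Y x)"

text \<open>\<open>h\<close> is tensorial, so its value on two tangent vectors at \<open>x\<close> is computed by extending them to
  constant vector fields.\<close>

definition second_form ::
  "('a::euclidean_space \<Rightarrow> real^('n::finite option)) \<Rightarrow> ('a \<Rightarrow> real^('n option)) \<Rightarrow>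
   'a \<Rightarrow> 'a \<Rightarrow> 'a \<Rightarrow> real" where
  "second_form F \<xi> x v w = transversal_part F \<xi> x (flat_deriv F (\<lambda>_. v) (\<lambda>_. w) x)"

text \<open>Weingarten formula \<open>D_X \<xi> = - dF (S X) + \<tau>(X) \<xi>\<close>.\<close>

definition shape_operator ::
  "('a::euclidean_space \<Rightarrow> real^('n::finite option)) \<Rightarrow> ('a \<Rightarrow> real^('n option)) \<Rightarrow> 'a \<Rightarrow> 'a \<Rightarrow> 'a" where
  "shape_operator F \<xi> x v = - tangential_part F \<xi> x (frechet_derivative \<xi> (at x) v)"

definition induced_volume ::
  "('a::euclidean_space \<Rightarrow> real^('n::finite option)) \<Rightarrow> ('a \<Rightarrow> real^('n option)) \<Rightarrow>
   'a \<Rightarrow> ('n \<Rightarrow> 'a) \<Rightarrow> real" where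
  "induced_volume F \<xi> x X =
     det (\<chi> k. case k of Some i \<Rightarrow> frechet_derivative F (at x) (X i) | None \<Rightarrow> \<xi> x)"


subsection \<open>The affine normal\<close>

definition nondegenerate :: "('a::real_vector \<Rightarrow> 'a \<Rightarrow> real) \<Rightarrow> bool" where
  "nondegenerate b \<longleftrightarrow> (\<forall>v. (\<forall>w. b v w = 0) \<longrightarrow> v = 0)"

definition pos_definite :: "('a::real_vector \<Rightarrow> 'a \<Rightarrow> real) \<Rightarrow> bool" where
  "pos_definite b \<longleftrightarrow> (\<forall>v. v \<noteq> 0 \<longrightarrow> b v v > 0)"

definition neg_definite :: "('a::real_vector \<Rightarrow> 'a \<Rightarrow> real) \<Rightarrow> bool" where
  "neg_definite b \<longleftrightarrow> (\<forall>v. v \<noteq> 0 \<longrightarrow> b v v < 0)"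

text \<open>\<open>\<nabla>\<omega> = 0\<close>, that is,
  \<open>Z (\<omega>(X_1,...,X_n)) = \<Sum>_i \<omega>(X_1,...,\<nabla>_Z X_i,...,X_n)\<close>.\<close>

definition volume_parallel ::
  "'a::euclidean_space set \<Rightarrow> ('a \<Rightarrow> real^('n::finite option)) \<Rightarrow> ('a \<Rightarrow> real^('n option)) \<Rightarrow> bool" where
  "volume_parallel M F \<xi> \<longleftrightarrow>
     (\<forall>Z (X :: 'n \<Rightarrow> 'a \<Rightarrow> 'a). smooth_on M Z \<and> (\<forall>i. smooth_on M (X i)) \<longrightarrow>
        (\<forall>x\<in>M. frechet_derivative (\<lambda>y. induced_volume F \<xi> y (\<lambda>i. X i y)) (at x) (Z x) =
          (\<Sum>i\<in>UNIV. induced_volume F \<xi> x ((\<lambda>j. X j x)(i := induced_conn F \<xi> Z (X i) x)))))"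

text \<open>Affine normal field, without a choice of sign: \<open>\<xi>\<close> and \<open>-\<xi>\<close> satisfy this together.\<close>

definition affine_normal ::
  "'a::euclidean_space set \<Rightarrow> ('a \<Rightarrow> real^('n::finite option)) \<Rightarrow> ('a \<Rightarrow> real^('n option)) \<Rightarrow> bool" where
  "affine_normal M F \<xi> \<longleftrightarrow>
     immersed_hypersurface M F \<and> transversal_field M F \<xi> \<and>
     (\<forall>x\<in>M. nondegenerate (second_form F \<xi> x)) \<and>
     volume_parallel M F \<xi> \<and>
     (\<forall>x\<in>M. \<forall>X :: 'n \<Rightarrow> 'a. inj X \<and> independent (range X) \<longrightarrow>
        (induced_volume F \<xi> x X)\<^sup>2 = \<bar>det (\<chi> i j. second_form F \<xi> x (X i) (X j))\<bar>)"

text \<open>Whether \<open>h\<close> is definite does not depend on the transversal field.\<close>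

definition convex_hypersurface ::
  "'a::euclidean_space set \<Rightarrow> ('a \<Rightarrow> real^('n::finite option)) \<Rightarrow> bool" where
  "convex_hypersurface M F \<longleftrightarrow>
     immersed_hypersurface M F \<and>
     (\<exists>\<xi>. transversal_field M F \<xi> \<and>
        (\<forall>x\<in>M. pos_definite (second_form F \<xi> x) \<or> neg_definite (second_form F \<xi> x)))"

text \<open>The affine normal of a convex hypersurface, with its sign normalised.\<close>

definition convex_affine_normal ::
  "'a::euclidean_space set \<Rightarrow> ('a \<Rightarrow> real^('n::finite option)) \<Rightarrow> ('a \<Rightarrow> real^('n option)) \<Rightarrow> bool" where
  "convex_affine_normal M F \<xi> \<longleftrightarrow>
     affine_normal M F \<xi> \<and> (\<forall>x\<in>M. pos_definite (second_form F \<xi> x))"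


subsection \<open>Levi-Civita connection and difference tensor\<close>

definition affine_connection ::
  "'a::euclidean_space set \<Rightarrow> (('a \<Rightarrow> 'a) \<Rightarrow> ('a \<Rightarrow> 'a) \<Rightarrow> 'a \<Rightarrow> 'a) \<Rightarrow> bool" where
  "affine_connection M N \<longleftrightarrow>
     (\<forall>X Y. smooth_on M X \<and> smooth_on M Y \<longrightarrow> smooth_on M (N X Y)) \<and>
     (\<forall>X X' Y. smooth_on M X \<and> smooth_on M X' \<and> smooth_on M Y \<longrightarrow>
        (\<forall>x\<in>M. N (\<lambda>y. X y + X' y) Y x = N X Y x + N X' Y x)) \<and>
     (\<forall>X Y Y'. smooth_on M X \<and> smooth_on M Y \<and> smooth_on M Y' \<longrightarrow>
        (\<forall>x\<in>M. N X (\<lambda>y. Y y + Y' y) x = N X Y x + N X Y' x)) \<and>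
     (\<forall>(f :: 'a \<Rightarrow> real) X Y. smooth_on M f \<and> smooth_on M X \<and> smooth_on M Y \<longrightarrow>
        (\<forall>x\<in>M. N (\<lambda>y. f y *\<^sub>R X y) Y x = f x *\<^sub>R N X Y x \<and>
               N X (\<lambda>y. f y *\<^sub>R Y y) x =
                 frechet_derivative f (at x) (X x) *\<^sub>R Y x + f x *\<^sub>R N X Y x))"

text \<open>The Lie bracket is \<open>[X,Y] = dY(X) - dX(Y)\<close> since the charts are open subsets of \<open>'a\<close>.\<close>

definition levi_civita ::
  "'a::euclidean_space set \<Rightarrow> ('a \<Rightarrow> 'a \<Rightarrow> 'a \<Rightarrow> real) \<Rightarrow>
   (('a \<Rightarrow> 'a) \<Rightarrow> ('a \<Rightarrow> 'a) \<Rightarrow> 'a \<Rightarrow> 'a) \<Rightarrow> bool" where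
  "levi_civita M g N \<longleftrightarrow>
     affine_connection M N \<and>
     (\<forall>X Y. smooth_on M X \<and> smooth_on M Y \<longrightarrow>
        (\<forall>x\<in>M. N X Y x - N Y X x =
           frechet_derivative Y (at x) (X x) - frechet_derivative X (at x) (Y x))) \<and>
     (\<forall>X Y Z. smooth_on M X \<and> smooth_on M Y \<and> smooth_on M Z \<longrightarrow>
        (\<forall>x\<in>M. frechet_derivative (\<lambda>y. g y (Y y) (Z y)) (at x) (X x) =
           g x (N X Y x) (Z x) + g x (Y x) (N X Z x)))"

text \<open>\<open>K = \<nabla> - N\<close> is tensorial; tangent vectors are again extended to constant fields.\<close>

definition difference_tensor ::
  "('a::euclidean_space \<Rightarrow> real^('n::finite option)) \<Rightarrow> ('a \<Rightarrow> real^('n option)) \<Rightarrow>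
   (('a \<Rightarrow> 'a) \<Rightarrow> ('a \<Rightarrow> 'a) \<Rightarrow> 'a \<Rightarrow> 'a) \<Rightarrow> 'a \<Rightarrow> 'a \<Rightarrow> 'a \<Rightarrow> 'a" where
  "difference_tensor F \<xi> N x v w =
     induced_conn F \<xi> (\<lambda>_. v) (\<lambda>_. w) x - N (\<lambda>_. v) (\<lambda>_. w) x"


subsection \<open>Pointwise \<open>SO(n-1)\<close> symmetry\<close>

text \<open>\<open>E\<close> is a basis, orthonormal for \<open>b\<close>, of the \<open>b\<close>-orthogonal complement of \<open>v\<close>.\<close>

definition orthonormal_basis_of_complement ::
  "('a::euclidean_space \<Rightarrow> 'a \<Rightarrow> real) \<Rightarrow> 'a \<Rightarrow> ('m::finite \<Rightarrow> 'a) \<Rightarrow> bool" where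
  "orthonormal_basis_of_complement b v E \<longleftrightarrow>
     (\<forall>i j. b (E i) (E j) = (if i = j then 1 else 0)) \<and> span (range E) = {w. b v w = 0}"

text \<open>\<open>g\<close> maps the span of \<open>E\<close> to itself, with a matrix in \<open>SO(n-1)\<close>.\<close>

definition acts_by_rotation :: "('m::finite \<Rightarrow> 'a::real_vector) \<Rightarrow> ('a \<Rightarrow> 'a) \<Rightarrow> bool" where
  "acts_by_rotation E g \<longleftrightarrow>
     (\<exists>A :: real^'m^'m. rotation_matrix A \<and> (\<forall>j. g (E j) = (\<Sum>i\<in>UNIV. (A $ i $ j) *\<^sub>R E i)))"

text \<open>Here \<open>n = CARD('m option)\<close>, so that \<open>'m\<close> has \<open>n-1\<close> elements. The normal \<open>\<xi>\<close> and the Levi-Civita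
  connection \<open>N\<close> are unique on \<open>M\<close>; the existential quantifiers only name them.\<close>

definition pointwise_SO_symmetry ::
  "'a::euclidean_space set \<Rightarrow> ('a \<Rightarrow> real^('m::finite option option)) \<Rightarrow> bool" where
  "pointwise_SO_symmetry M F \<longleftrightarrow>
     (\<exists>\<xi> N. convex_affine_normal M F \<xi> \<and> levi_civita M (second_form F \<xi>) N \<and>
       (\<forall>p\<in>M. \<exists>X1. second_form F \<xi> p X1 X1 = 1 \<and>
         (\<forall>g. linear g \<and> bij g \<and> g X1 = X1 \<and>
              (\<exists>E :: 'm \<Rightarrow> 'a. orthonormal_basis_of_complement (second_form F \<xi> p) X1 E \<and>
                 acts_by_rotation E g) \<longrightarrow>
            (\<forall>X Y. shape_operator F \<xi> p (g X) = g (shape_operator F \<xi> p X) \<and>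
               difference_tensor F \<xi> N p (g X) (g Y) = g (difference_tensor F \<xi> N p X Y)))))"


subsection \<open>The hypersurface\<close>

text \<open>In \<open>real^('m option option)\<close> the coordinates \<open>Some (Some i)\<close> are the first \<open>n-1\<close> ones,
  \<open>Some None\<close> is the \<open>n\<close>-th and \<open>None\<close> the \<open>(n+1)\<close>-st one.\<close>

definition F_map :: "(real \<Rightarrow> real) \<Rightarrow> (real \<Rightarrow> real) \<Rightarrow> real \<times> (real^'m::finite) \<Rightarrow> real^('m option option)" where
  "F_map \<gamma>1 \<gamma>2 = (\<lambda>(t, u). \<chi> k. case k of
     Some (Some i) \<Rightarrow> u $ i
   | Some None \<Rightarrow> (norm u)\<^sup>2 / 2 + \<gamma>1 t
   | None \<Rightarrow> \<gamma>2 t)"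

definition curve_det :: "(real \<Rightarrow> real) \<Rightarrow> (real \<Rightarrow> real) \<Rightarrow> real \<Rightarrow> real" where
  "curve_det \<gamma>1 \<gamma>2 t = deriv (deriv \<gamma>1) t * deriv \<gamma>2 t - deriv (deriv \<gamma>2) t * deriv \<gamma>1 t"

definition normal_field ::
  "(real \<Rightarrow> real) \<Rightarrow> (real \<Rightarrow> real) \<Rightarrow> (real \<Rightarrow> real) \<Rightarrow> (real \<Rightarrow> real) \<Rightarrow>
   real \<times> (real^'m::finite) \<Rightarrow> real^('m option option)" where
  "normal_field \<gamma>1 \<gamma>2 \<mu> \<nu> = (\<lambda>(t, u).
     \<mu> t *\<^sub>R axis (Some None) 1 + \<nu> t *\<^sub>R vector_derivative (\<lambda>s. F_map \<gamma>1 \<gamma>2 (s, u)) (at t))"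

text \<open>The sign \<open>s\<close> is the same on all of \<open>I\<close>.\<close>

definition normal_equations ::
  "real set \<Rightarrow> nat \<Rightarrow> (real \<Rightarrow> real) \<Rightarrow> (real \<Rightarrow> real) \<Rightarrow> (real \<Rightarrow> real) \<Rightarrow> (real \<Rightarrow> real) \<Rightarrow> bool" where
  "normal_equations I n \<gamma>1 \<gamma>2 \<mu> \<nu> \<longleftrightarrow>
     (\<forall>t\<in>I. (\<mu> has_real_derivative - \<nu> t * (curve_det \<gamma>1 \<gamma>2 t / deriv \<gamma>2 t)) (at t)) \<and>
     (\<exists>s\<in>{1, -1}. \<forall>t\<in>I. \<mu> t ^ (n + 2) * deriv \<gamma>2 t ^ 3 = s * curve_det \<gamma>1 \<gamma>2 t)"

end

theory Submission
  imports Defs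
begin

text \<open>
  Write \<open>D = (\<gamma>\<^sub>1'' \<gamma>\<^sub>2' - \<gamma>\<^sub>2'' \<gamma>\<^sub>1') / \<gamma>\<^sub>2'\<close>. At each point let \<open>\<ell>\<close> be the covector that annihilates the
  tangent space and satisfies \<open>\<ell>(e_n) = 1\<close>. For a transversal field \<open>\<xi>\<close> one finds
  \<open>h = (D dt\<^sup>2 + |du|\<^sup>2) / \<ell>(\<xi>)\<close>, \<open>\<omega> = -\<ell>(\<xi>) \<gamma>\<^sub>2' dt \<and> du\<close> up to the order of coordinates, and
  \<open>\<nabla>\<omega> = \<tau> \<otimes> \<omega>\<close> with \<open>\<tau>(Z) = \<ell>(D_Z \<xi>) / \<ell>(\<xi>)\<close>. Hence \<open>\<xi>\<close> is the affine normal exactly when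
  \<open>\<ell>(\<xi>) = \<mu>\<close> with \<open>\<mu>^{n+2} = D / \<gamma>\<^sub>2'\<^sup>2\<close> and \<open>\<ell>(D_Z \<xi>) = 0\<close> for all \<open>Z\<close>. Differentiating
  \<open>\<ell>(\<xi>) = \<mu>\<close> turns the second condition into linear equations for the components of \<open>\<xi>\<close>, solved
  by \<open>\<mu> e_n + \<nu> \<partial>_t\<close> only. The affine metric is then a warped metric \<open>P(t) dt\<^sup>2 + Q(t) |du|\<^sup>2\<close>,
  and \<open>S\<close> and \<open>K\<close> are built from \<open>dt\<close>, \<open>\<partial>_t\<close>, \<open>du\<close> and \<open>|du|\<^sup>2\<close>, so they commute with the rotations
  fixing \<open>\<partial>_t\<close>.
\<close>

section \<open>Smooth maps\<close>

lemma k_times_diff_on_cong: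
  assumes "open M" "\<And>x. x \<in> M \<Longrightarrow> f x = g x" "k_times_diff_on k M f"
  shows "k_times_diff_on k M g"
  using assms(2,3)
proof (induction k arbitrary: f g)
  case 0
  then show ?case
    by (auto cong: continuous_on_cong)
next
  case (Suc k)
  have d: "f differentiable at x" if "x \<in> M" for x
    using Suc.prems that by simp
  have "g differentiable at x" if "x \<in> M" for x
    using d[OF that] that assms(1) Suc.prems(1)
    unfolding differentiable_def by (meson has_derivative_transform_within_open)
  \<comment> \<open>Since \<open>M\<close> is open, derivatives at its points depend only on values
    on \<open>M\<close>, so agreement on \<open>M\<close> passes to the directional
    derivatives.\<close>
  moreover have "frechet_derivative f (at x) v = frechet_derivative g (at x) v" if "x \<in> M" for x v
    using frechet_derivative_transform_within_open[OF d[OF that] assms(1) that, of g] Suc.prems(1)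
    by simp
  moreover have "k_times_diff_on k M (\<lambda>x. frechet_derivative f (at x) v)" for v
    using Suc.prems by simp
  ultimately show ?case
    using Suc.IH[of "\<lambda>x. frechet_derivative f (at x) _" "\<lambda>x. frechet_derivative g (at x) _"] by simp
qed

text \<open>Any explicit derivative formula may stand in for \<open>frechet_derivative\<close>; the
  inductions for sums, products, inverses and powers advance through this rule.\<close>

lemma k_times_diff_on_SucI:
  assumes "open M" "\<And>x. x \<in> M \<Longrightarrow> (f has_derivative f' x) (at x)"
    and "\<And>v. k_times_diff_on k M (\<lambda>x. f' x v)"
  shows "k_times_diff_on (Suc k) M f"
proof -
  have "frechet_derivative f (at x) v = f' x v" if "x \<in> M" for x v
    using frechet_derivative_at[OF assms(2)[OF that]] by simp
  moreover have "f differentiable at x" if "x \<in> M" for x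
    using assms(2)[OF that] by (auto simp: differentiable_def)
  ultimately show ?thesis
    using k_times_diff_on_cong[OF assms(1) _ assms(3)] by simp
qed

lemma k_times_diff_on_SucD:
  assumes "k_times_diff_on (Suc k) M f"
  shows "x \<in> M \<Longrightarrow> (f has_derivative frechet_derivative f (at x)) (at x)"
    and "k_times_diff_on k M (\<lambda>x. frechet_derivative f (at x) v)"
  using assms by (auto simp: frechet_derivative_works[symmetric])

text \<open>The definition asks for continuity only at the bottom of the recursion, where
  differentiability supplies it. Product rules use this because one factor stays
  undifferentiated.\<close>

lemma k_times_diff_on_Suc_imp: "k_times_diff_on (Suc k) M f \<Longrightarrow> k_times_diff_on k M f"
proof (induction k arbitrary: f)
  case 0
  then show ?case
    by (auto intro: differentiable_imp_continuous_on
        simp: differentiable_on_def differentiable_at_withinI)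
qed simp

lemma k_times_diff_on_const: "k_times_diff_on k M (\<lambda>x. c)"
  by (induction k arbitrary: c) auto

lemma k_times_diff_on_linear:
  assumes "open M" "bounded_linear L" "k_times_diff_on k M f"
  shows "k_times_diff_on k M (\<lambda>x. L (f x))"
  using assms(3)
proof (induction k arbitrary: f)
  case 0
  then show ?case
    using bounded_linear.continuous_on[OF assms(2)] by simp
next
  case (Suc k)
  show ?case
    by (rule k_times_diff_on_SucI[OF assms(1)])
      (use k_times_diff_on_SucD[OF Suc.prems] Suc.IH in
        \<open>auto intro!: bounded_linear.has_derivative[OF assms(2)]\<close>)
qed

lemma k_times_diff_on_add:
  assumes "open M" "k_times_diff_on k M f" "k_times_diff_on k M g"
  shows "k_times_diff_on k M (\<lambda>x. f x + g x)"
  using assms(2,3)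
proof (induction k arbitrary: f g)
  case 0
  then show ?case
    by (simp add: continuous_on_add)
next
  case (Suc k)
  show ?case
    by (rule k_times_diff_on_SucI[OF assms(1)])
      (use k_times_diff_on_SucD[OF Suc.prems(1)] k_times_diff_on_SucD[OF Suc.prems(2)] Suc.IH in
        \<open>auto intro!: has_derivative_add\<close>)
qed

lemma k_times_diff_on_bilinear:
  assumes "open M" "bounded_bilinear B" "k_times_diff_on k M f" "k_times_diff_on k M g"
  shows "k_times_diff_on k M (\<lambda>x. B (f x) (g x))"
  using assms(3,4)
proof (induction k arbitrary: f g)
  case 0
  then show ?case
    by (simp add: bounded_bilinear.continuous_on[OF assms(2)])
next
  case (Suc k)
  show ?case
    by (rule k_times_diff_on_SucI[OF assms(1) bounded_bilinear.FDERIV[OF assms(2)]])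
      (use k_times_diff_on_SucD[OF Suc.prems(1)] k_times_diff_on_SucD[OF Suc.prems(2)] Suc
        in \<open>auto intro!: k_times_diff_on_add[OF assms(1)] Suc.IH intro: k_times_diff_on_Suc_imp
           simp del: k_times_diff_on.simps\<close>)
qed

text \<open>The derivative is a product of \<open>inverse (f x)\<close> with a derivative of
  \<open>f\<close>, so order \<open>k\<close> of the inverse itself feeds order
  \<open>Suc k\<close>.\<close>

lemma k_times_diff_on_inverse:
  fixes f :: "'a::real_normed_vector \<Rightarrow> real"
  assumes "open M" "\<And>x. x \<in> M \<Longrightarrow> f x \<noteq> 0" "k_times_diff_on k M f"
  shows "k_times_diff_on k M (\<lambda>x. inverse (f x))"
  using assms(3)
proof (induction k)
  case 0
  then show ?case
    using assms(2) by (auto intro!: continuous_on_inverse)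
next
  case (Suc k)
  have i: "k_times_diff_on k M (\<lambda>x. inverse (f x))"
    using Suc k_times_diff_on_Suc_imp by blast
  show ?case
  proof (rule k_times_diff_on_SucI[OF assms(1)])
    show "((\<lambda>x. inverse (f x)) has_derivative
        (\<lambda>v. - (inverse (f x) * frechet_derivative f (at x) v * inverse (f x)))) (at x)"
      if "x \<in> M" for x
      using Deriv.has_derivative_inverse[OF assms(2)[OF that] k_times_diff_on_SucD(1)[OF Suc.prems that]]
      by simp
    show "k_times_diff_on k M (\<lambda>x. - (inverse (f x) * frechet_derivative f (at x) v * inverse (f x)))"
      for v
      by (intro k_times_diff_on_linear[OF assms(1) bounded_linear_minus[OF bounded_linear_ident]]
          k_times_diff_on_bilinear[OF assms(1) bounded_bilinear_mult] i
          k_times_diff_on_SucD(2)[OF Suc.prems])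
  qed
qed

text \<open>Differentiation lowers the exponent by one, hence the induction ranges over all
  \<open>a\<close>.\<close>

lemma k_times_diff_on_powr:
  fixes f :: "'a::real_normed_vector \<Rightarrow> real"
  assumes "open M" "\<And>x. x \<in> M \<Longrightarrow> f x > 0" "k_times_diff_on k M f"
  shows "k_times_diff_on k M (\<lambda>x. f x powr a)"
  using assms(3)
proof (induction k arbitrary: a)
  case 0
  then show ?case
    using assms(2) by (auto intro!: continuous_on_powr simp: less_imp_neq[symmetric])
next
  case (Suc k)
  have i: "k_times_diff_on k M (\<lambda>x. f x powr a)" for a
    using Suc k_times_diff_on_Suc_imp by blast
  show ?case
  proof (rule k_times_diff_on_SucI[OF assms(1)])
    show "((\<lambda>x. f x powr a) has_derivative
        (\<lambda>v. a *\<^sub>R (f x powr (a - 1) * frechet_derivative f (at x) v))) (at x)"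
      if "x \<in> M" for x
      using has_derivative_powr[OF k_times_diff_on_SucD(1)[OF Suc.prems that]
          has_derivative_const[of a] assms(2)[OF that] UNIV_I]
      by (rule has_derivative_eq_rhs) (use assms(2)[OF that] in \<open>auto simp: powr_diff fun_eq_iff\<close>)
    show "k_times_diff_on k M (\<lambda>x. a *\<^sub>R (f x powr (a - 1) * frechet_derivative f (at x) v))" for v
      by (intro k_times_diff_on_linear[OF assms(1) bounded_linear_scaleR_right]
          k_times_diff_on_bilinear[OF assms(1) bounded_bilinear_mult] i
          k_times_diff_on_SucD(2)[OF Suc.prems])
  qed
qed

lemma has_derivative_fst_compose:
  "(f has_derivative f') (at (fst x)) \<Longrightarrow> ((\<lambda>y. f (fst y)) has_derivative (\<lambda>v. f' (fst v))) (at x)"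
  by (auto intro!: has_derivative_compose[of fst fst] derivative_eq_intros)

text \<open>For a fixed direction the derivative is again a function of \<open>fst x\<close>, namely
  a directional derivative of \<open>f\<close>; the induction therefore varies
  \<open>f\<close>.\<close>

lemma k_times_diff_on_fst:
  assumes "open I" "open U" "k_times_diff_on k I f"
  shows "k_times_diff_on k (I \<times> U) (\<lambda>x. f (fst x))"
  using assms(3)
proof (induction k arbitrary: f)
  case 0
  then show ?case
    by (auto intro!: continuous_on_compose2[of I f] continuous_intros)
next
  case (Suc k)
  show ?case
  proof (rule k_times_diff_on_SucI[OF open_Times[OF assms(1,2)]])
    show "((\<lambda>x. f (fst x)) has_derivative (\<lambda>v. frechet_derivative f (at (fst x)) (fst v))) (at x)"
      if "x \<in> I \<times> U" for x
      by (rule has_derivative_fst_compose[OF k_times_diff_on_SucD(1)[OF Suc.prems]]) (use that in auto)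
    show "k_times_diff_on k (I \<times> U) (\<lambda>x. frechet_derivative f (at (fst x)) (fst v))" for v
      using Suc.IH[OF k_times_diff_on_SucD(2)[OF Suc.prems]] .
  qed
qed

section \<open>Calculus of smooth maps\<close>

lemma smooth_on_cong:
  "open M \<Longrightarrow> (\<And>x. x \<in> M \<Longrightarrow> f x = g x) \<Longrightarrow> smooth_on M f \<longleftrightarrow> smooth_on M g"
  unfolding smooth_on_def by (metis k_times_diff_on_cong)

lemma smooth_on_has_derivative:
  "smooth_on M f \<Longrightarrow> x \<in> M \<Longrightarrow> (f has_derivative frechet_derivative f (at x)) (at x)"
  unfolding smooth_on_def using k_times_diff_on_SucD(1) by blast

lemma smooth_on_linear_derivative:
  "smooth_on M f \<Longrightarrow> x \<in> M \<Longrightarrow> linear (frechet_derivative f (at x))"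
  by (meson has_derivative_linear smooth_on_has_derivative)

lemma smooth_on_directional_derivative:
  "smooth_on M f \<Longrightarrow> smooth_on M (\<lambda>x. frechet_derivative f (at x) v)"
  unfolding smooth_on_def using k_times_diff_on_SucD(2) by blast

lemma smooth_on_const: "smooth_on M (\<lambda>x. c)"
  by (simp add: smooth_on_def k_times_diff_on_const)

lemma smooth_on_linear:
  "open M \<Longrightarrow> bounded_linear L \<Longrightarrow> smooth_on M f \<Longrightarrow> smooth_on M (\<lambda>x. L (f x))"
  by (simp add: smooth_on_def k_times_diff_on_linear)

lemma smooth_on_ident: "open M \<Longrightarrow> smooth_on M (\<lambda>x. x)"
  unfolding smooth_on_def
proof
  fix k
  show "open M \<Longrightarrow> k_times_diff_on k M (\<lambda>x. x)"
  proof (cases k)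
    case (Suc k)
    then show "open M \<Longrightarrow> ?thesis"
      using k_times_diff_on_SucI[OF _ has_derivative_ident k_times_diff_on_const] by blast
  qed simp
qed

lemma smooth_on_add:
  "open M \<Longrightarrow> smooth_on M f \<Longrightarrow> smooth_on M g \<Longrightarrow> smooth_on M (\<lambda>x. f x + g x)"
  by (simp add: smooth_on_def k_times_diff_on_add)

lemma smooth_on_sum:
  "open M \<Longrightarrow> (\<And>i. i \<in> A \<Longrightarrow> smooth_on M (f i)) \<Longrightarrow> smooth_on M (\<lambda>x. \<Sum>i\<in>A. f i x)"
  by (induction A rule: infinite_finite_induct) (auto intro: smooth_on_add smooth_on_const)

lemma smooth_on_bilinear:
  "open M \<Longrightarrow> bounded_bilinear B \<Longrightarrow> smooth_on M f \<Longrightarrow> smooth_on M g \<Longrightarrow>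
   smooth_on M (\<lambda>x. B (f x) (g x))"
  by (simp add: smooth_on_def k_times_diff_on_bilinear)

lemmas smooth_on_mult = smooth_on_bilinear[OF _ bounded_bilinear_mult]
lemmas smooth_on_scaleR = smooth_on_bilinear[OF _ bounded_bilinear_scaleR]
lemmas smooth_on_inner = smooth_on_bilinear[OF _ bounded_bilinear_inner]
lemmas smooth_on_minus = smooth_on_linear[OF _ bounded_linear_minus[OF bounded_linear_ident]]
lemmas smooth_on_fst = smooth_on_linear[OF _ bounded_linear_fst]
lemmas smooth_on_snd = smooth_on_linear[OF _ bounded_linear_snd]

lemma smooth_on_Pair:
  assumes "open M" "smooth_on M f" "smooth_on M g"
  shows "smooth_on M (\<lambda>x. (f x, g x))"
proof -
  have "smooth_on M (\<lambda>x. (f x, 0) + (0, g x))"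
    by (intro smooth_on_add smooth_on_linear[where L = "\<lambda>a. (a, 0)"]
        smooth_on_linear[where L = "\<lambda>a. (0, a)"] assms bounded_linear_Pair
        bounded_linear_ident bounded_linear_zero)
  then show ?thesis
    by simp
qed

lemma smooth_on_inverse:
  fixes f :: "'a::real_normed_vector \<Rightarrow> real"
  shows "open M \<Longrightarrow> smooth_on M f \<Longrightarrow> (\<And>x. x \<in> M \<Longrightarrow> f x \<noteq> 0) \<Longrightarrow> smooth_on M (\<lambda>x. inverse (f x))"
  by (simp add: smooth_on_def k_times_diff_on_inverse)

lemma smooth_on_divide:
  fixes f :: "'a::real_normed_vector \<Rightarrow> real"
  shows "open M \<Longrightarrow> smooth_on M f \<Longrightarrow> smooth_on M g \<Longrightarrow> (\<And>x. x \<in> M \<Longrightarrow> g x \<noteq> 0) \<Longrightarrow>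
    smooth_on M (\<lambda>x. f x / g x)"
  unfolding divide_inverse by (intro smooth_on_mult smooth_on_inverse)

lemma smooth_on_powr:
  fixes f :: "'a::real_normed_vector \<Rightarrow> real"
  shows "open M \<Longrightarrow> smooth_on M f \<Longrightarrow> (\<And>x. x \<in> M \<Longrightarrow> f x > 0) \<Longrightarrow> smooth_on M (\<lambda>x. f x powr a)"
  by (simp add: smooth_on_def k_times_diff_on_powr)

lemma smooth_on_compose_fst:
  "open I \<Longrightarrow> open U \<Longrightarrow> smooth_on I f \<Longrightarrow> smooth_on (I \<times> U) (\<lambda>x. f (fst x))"
  by (simp add: smooth_on_def k_times_diff_on_fst)

text \<open>Smoothness is defined through derivatives in constant directions; expanding
  \<open>X x\<close> in \<open>Basis\<close> reduces a variable direction to these.\<close>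

lemma smooth_on_derivative_along:
  fixes X :: "'a::euclidean_space \<Rightarrow> 'a"
  assumes "open M" "smooth_on M f" "smooth_on M X"
  shows "smooth_on M (\<lambda>x. frechet_derivative f (at x) (X x))"
proof -
  have "smooth_on M (\<lambda>x. \<Sum>b\<in>Basis. (X x \<bullet> b) *\<^sub>R frechet_derivative f (at x) b)"
    by (intro smooth_on_sum smooth_on_scaleR smooth_on_inner smooth_on_const
        smooth_on_directional_derivative assms)
  then show ?thesis
  proof (rule iffD1[OF smooth_on_cong[OF assms(1)], rotated])
    fix x assume that: "x \<in> M"
    let ?L = "frechet_derivative f (at x)"
    have "?L (\<Sum>b\<in>Basis. (X x \<bullet> b) *\<^sub>R b) = (\<Sum>b\<in>Basis. (X x \<bullet> b) *\<^sub>R ?L b)"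
      using smooth_on_linear_derivative[OF assms(2) that]
      by (simp add: linear_sum[of ?L] linear_scale[of ?L])
    then show "(\<Sum>b\<in>Basis. (X x \<bullet> b) *\<^sub>R ?L b) = ?L (X x)"
      by (simp only: euclidean_representation)
  qed
qed

text \<open>On the real line the Frechet derivative is multiplication by its value at 1, which is
  \<open>deriv f\<close>.\<close>

lemma smooth_on_deriv:
  fixes f :: "real \<Rightarrow> real"
  assumes "open I" "smooth_on I f"
  shows "smooth_on I (deriv f)" and "t \<in> I \<Longrightarrow> (f has_real_derivative deriv f t) (at t)"
proof -
  have f: "(f has_real_derivative frechet_derivative f (at t) 1) (at t)" if "t \<in> I" for t
  proof -
    have "frechet_derivative f (at t) = (*) (frechet_derivative f (at t) 1)"
    proof
      fix v
      show "frechet_derivative f (at t) v = frechet_derivative f (at t) 1 * v"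
        using linear_scale[OF smooth_on_linear_derivative[OF assms(2) that], of v 1]
        by (simp add: mult.commute)
    qed
    then show ?thesis
      unfolding has_field_derivative_def
      using smooth_on_has_derivative[OF assms(2) that] by simp
  qed
  have eq: "frechet_derivative f (at t) 1 = deriv f t" if "t \<in> I" for t
    by (rule DERIV_imp_deriv[OF f[OF that], symmetric])
  show "smooth_on I (deriv f)"
    by (rule iffD1[OF smooth_on_cong[OF assms(1)] smooth_on_directional_derivative[OF assms(2)]])
      (rule eq)
  show "(f has_real_derivative deriv f t) (at t)" if "t \<in> I"
    using f[OF that] unfolding eq[OF that] .
qed


section \<open>Determinants\<close>

text \<open>In the Leibniz formula a permutation that moves \<open>None\<close> picks a zero entry
  of the column \<open>None\<close>. Those fixing \<open>None\<close> are the maps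
  \<open>map_option q\<close> with \<open>q\<close> a permutation, and they have the sign of
  \<open>q\<close>.\<close>

lemma det_option_column:
  fixes A :: "'a::comm_ring_1^('n::finite option)^('n option)"
  assumes "\<And>i. A $ Some i $ None = 0"
  shows "det A = A $ None $ None * det (\<chi> i j. A $ Some i $ Some j)"
proof -
  let ?P = "{p :: 'n \<Rightarrow> 'n. p permutes UNIV}" and ?Q = "{p :: 'n option \<Rightarrow> 'n option. p permutes UNIV}"
  let ?t = "\<lambda>p. of_int (sign p) * (\<Prod>i\<in>UNIV. A $ i $ p i)"
  have inj: "inj (map_option :: ('n \<Rightarrow> 'n) \<Rightarrow> _)"
  proof (rule injI, rule ext)
    fix f g :: "'n \<Rightarrow> 'n" and x
    assume "map_option f = map_option g"
    then have "map_option f (Some x) = map_option g (Some x)"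
      by (rule fun_cong)
    then show "f x = g x"
      by simp
  qed
  \<comment> \<open>Recognising \<open>map_option p\<close> as a transported permutation yields both
    that it permutes and that its sign is that of \<open>p\<close>.\<close>
  have eq: "map_permutation UNIV Some p = map_option p" for p :: "'n \<Rightarrow> 'n"
  proof
    fix x
    show "map_permutation UNIV Some p x = map_option p x"
      by (cases x) (auto simp: map_permutation_def restrict_id_def)
  qed
  have perm: "map_option p permutes UNIV" if "p permutes UNIV" for p :: "'n \<Rightarrow> 'n"
    using map_permutation_permutes[OF _ that, of Some "range Some"] permutes_subset[of _ "range Some" UNIV]
    by (simp add: eq inj_on_imp_bij_betw)
  have sgn: "sign (map_option p) = sign p" if "p permutes UNIV" for p :: "'n \<Rightarrow> 'n"
    using sign_map_permutation[OF _ that, of Some] by (simp add: eq)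
  have z: "?t p = 0" if "p \<in> ?Q - map_option ` ?P" for p
  proof (cases "p None = None")
    case True
    from that have bij: "bij p"
      by (auto dest: permutes_bij)
    have nn: "p (Some i) \<noteq> None" for i
      using injD[OF bij_is_inj[OF bij], of "Some i" None] True by auto
    \<comment> \<open>No \<open>Some i\<close> is sent to \<open>None\<close>, because
      \<open>None\<close> is already the image of itself; so \<open>the\<close> is applied to proper
      values only.\<close>
    define q where "q i = the (p (Some i))" for i
    have q: "p (Some i) = Some (q i)" for i
      using nn by (simp add: q_def)
    have pq: "p = map_option q"
    proof
      fix x show "p x = map_option q x"
        using True q by (cases x) auto
    qed
    have "inj q"
      using injD[OF bij_is_inj[OF bij]] q by (metis injI option.inject)
    then have "q permutes UNIV"
      using finite_UNIV_inj_surj[of q] by (intro bij_imp_permutes) (auto simp: bij_betw_def)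
    with that pq show ?thesis
      by blast
  next
    case False
    have "bij p"
      using that by (auto dest: permutes_bij)
    then obtain i where i: "p i = None"
      by (metis bij_is_surj surjD)
    with False obtain k where "i = Some k"
      by (cases i) auto
    then have "A $ i $ p i = 0"
      using assms i by simp
    then have "(\<Prod>i\<in>UNIV. A $ i $ p i) = 0"
      by (meson UNIV_I finite prod_zero)
    then show ?thesis
      by simp
  qed
  have "det A = sum ?t (map_option ` ?P)"
    unfolding det_def by (rule sum.mono_neutral_right) (use perm z in auto)
  also have "\<dots> = (\<Sum>p\<in>?P. ?t (map_option p))"
    using inj by (subst sum.reindex) (auto simp: inj_on_def)
  also have "\<dots> = (\<Sum>p\<in>?P. A $ None $ None * (of_int (sign p) * (\<Prod>i\<in>UNIV. A $ Some i $ Some (p i))))"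
  proof (rule sum.cong)
    fix p assume p: "p \<in> ?P"
    have "(\<Prod>i\<in>UNIV. A $ i $ map_option p i)
        = A $ None $ None * (\<Prod>i\<in>UNIV. A $ Some i $ Some (p i))"
      unfolding UNIV_option_conv by (simp add: prod.reindex)
    then show "?t (map_option p) = A $ None $ None * (of_int (sign p) * (\<Prod>i\<in>UNIV. A $ Some i $ Some (p i)))"
      using sgn p by simp
  qed simp
  also have "\<dots> = A $ None $ None * det (\<chi> i j. A $ Some i $ Some j)"
    by (simp add: det_def sum_distrib_left)
  finally show ?thesis .
qed

text \<open>The product rule is applied to each Leibniz term; exchanging the sums over rows and
  permutations collects the terms into determinants with one differentiated row.\<close>

lemma has_derivative_det:
  fixes f :: "'n::finite \<Rightarrow> 'a::real_normed_vector \<Rightarrow> real^'n"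
  assumes "\<And>i. (f i has_derivative f' i) (at x)"
  shows "((\<lambda>y. det (\<chi> i. f i y)) has_derivative
    (\<lambda>v. \<Sum>k\<in>UNIV. det (\<chi> i. if i = k then f' k v else f i x))) (at x)"
proof -
  have c: "((\<lambda>y. f i y $ j) has_derivative (\<lambda>v. f' i v $ j)) (at x)" for i j
    using bounded_linear.has_derivative[OF bounded_linear_vec_nth assms] .
  have p: "(\<Prod>i\<in>UNIV. (if i = k then f' k v else f i x) $ p i)
      = f' k v $ p k * (\<Prod>i\<in>UNIV - {k}. f i x $ p i)" for k v p
    by (subst prod.remove[of _ k]) (auto intro!: prod.cong)
  have e: "(\<Sum>k\<in>UNIV. det (\<chi> i. if i = k then f' k v else f i x)) = (\<Sum>p | p permutes UNIV.
      of_int (sign p) * (\<Sum>k\<in>UNIV. f' k v $ p k * (\<Prod>i\<in>UNIV - {k}. f i x $ p i)))" for v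
    unfolding det_def vec_lambda_beta p sum_distrib_left by (rule sum.swap)
  show ?thesis
    unfolding e unfolding det_def vec_lambda_beta
    by (intro has_derivative_sum has_derivative_mult_right has_derivative_prod c)
qed

lemma sum_UNIV_option:
  "(\<Sum>k\<in>UNIV. f k) = f None + (\<Sum>i\<in>UNIV. f (Some i))" for f :: "'n::finite option \<Rightarrow> 'a::comm_monoid_add"
  unfolding UNIV_option_conv by (simp add: sum.reindex)

text \<open>The matrix is \<open>C\<close> times the diagonal matrix of \<open>g\<close> times the
  transpose of \<open>C\<close>: the Gram matrix of the rows of \<open>C\<close> for a diagonal
  form.\<close>

lemma det_gram:
  fixes C :: "real^'n::finite^'n"
  shows "det (\<chi> i j. \<Sum>k\<in>UNIV. C $ i $ k * (g k * C $ j $ k)) = prod g UNIV * (det C)\<^sup>2"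
proof -
  have "(\<chi> i j. \<Sum>k\<in>UNIV. C $ i $ k * (g k * C $ j $ k)) = C ** (\<chi> k. g k *s row k (transpose C))"
    by (simp add: matrix_matrix_mult_def vec_eq_iff row_def transpose_def)
  moreover have "(\<chi> k. row k (transpose C)) = transpose C"
    by (simp add: vec_eq_iff row_def)
  ultimately show ?thesis
    by (simp add: det_mul det_rows_mul power2_eq_square)
qed


section \<open>Coordinates\<close>

definition ambient :: "(real^'m::finite) \<times> real \<times> real \<Rightarrow> real^('m option option)" where
  "ambient = (\<lambda>(w, a, b). \<chi> k. case k of Some (Some i) \<Rightarrow> w $ i | Some None \<Rightarrow> a | None \<Rightarrow> b)"

definition horizontal :: "real^('m::finite option option) \<Rightarrow> real^'m" where
  "horizontal z = (\<chi> i. z $ Some (Some i))"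

definition coords :: "real \<times> (real^'m::finite) \<Rightarrow> real^('m option)" where
  "coords v = (\<chi> k. case k of Some i \<Rightarrow> snd v $ i | None \<Rightarrow> fst v)"

lemma ambient_nth [simp]:
  "ambient (w, a, b) $ Some (Some i) = w $ i"
  "ambient (w, a, b) $ Some None = a"
  "ambient (w, a, b) $ None = b"
  by (auto simp: ambient_def)

lemma coords_nth [simp]: "coords v $ Some i = snd v $ i" "coords v $ None = fst v"
  by (auto simp: coords_def)

lemma ambient_eqI:
  fixes z z' :: "real^('m::finite option option)"
  assumes "horizontal z = horizontal z'" "z $ Some None = z' $ Some None" "z $ None = z' $ None"
  shows "z = z'"
proof -
  have "z $ Some (Some i) = z' $ Some (Some i)" for i
    using arg_cong[OF assms(1), of "\<lambda>w. w $ i"] by (simp add: horizontal_def)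
  then have "z $ k = z' $ k" for k
    using assms(2,3) by (metis not_None_eq)
  then show ?thesis
    by (simp add: vec_eq_iff)
qed

lemma horizontal_simps [simp]:
  "horizontal (ambient (w, a, b)) = w"
  "horizontal (y + z) = horizontal y + horizontal z"
  "horizontal (y - z) = horizontal y - horizontal z"
  "horizontal (c *\<^sub>R z) = c *\<^sub>R horizontal z"
  "horizontal 0 = 0"
  by (auto simp: horizontal_def vec_eq_iff)

lemma bounded_linear_ambient: "bounded_linear ambient"
  unfolding linear_conv_bounded_linear[symmetric]
  by (rule linearI) (auto intro!: ambient_eqI)

lemma bounded_linear_horizontal: "bounded_linear horizontal"
  unfolding linear_conv_bounded_linear[symmetric] by (rule linearI) auto

lemma axis_eq_ambient: "axis (Some None) 1 = ambient (0, 1, 0)"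
  by (rule ambient_eqI) (auto simp: axis_def horizontal_def vec_eq_iff)

text \<open>The factor \<open>a\<close> sits in a column; transposition turns that column into a
  row, from which it can be pulled out.\<close>

lemma det_frame_columns:
  fixes X :: "'m::finite option \<Rightarrow> real \<times> (real^'m)"
  shows "det (\<chi> i j. case j of Some k \<Rightarrow> snd (X i) $ k | None \<Rightarrow> a * fst (X i))
    = a * det (\<chi> i. coords (X i))"
proof -
  let ?B = "\<chi> i j. case j of Some k \<Rightarrow> snd (X i) $ k | None \<Rightarrow> a * fst (X i)"
  let ?C = "transpose (\<chi> i. coords (X i))"
  have "det ?B = det (transpose ?B)"
    by (rule det_transpose[symmetric])
  also have "transpose ?B = (\<chi> j. if j = None then a *s row None ?C else row j ?C)"
    by (auto simp: vec_eq_iff transpose_def row_def coords_def split: option.splits)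
  also have "det \<dots> = a * det (\<chi> j. if j = None then row None ?C else row j ?C)"
    by (rule det_row_mul)
  also have "(\<chi> j. if j = None then row None ?C else row j ?C) = ?C"
    by (auto simp: vec_eq_iff row_def)
  also have "det ?C = det (\<chi> i. coords (X i))"
    by (rule det_transpose)
  finally show ?thesis .
qed

text \<open>A frame of determinant 1 on which the conditions defining the affine normal are
  evaluated to obtain necessary conditions.\<close>

definition standard_frame :: "'m::finite option \<Rightarrow> real \<times> (real^'m)" where
  "standard_frame i = (case i of Some k \<Rightarrow> (0, axis k 1) | None \<Rightarrow> (1, 0))"

lemma det_standard_frame:
  "det (\<chi> i. coords (standard_frame i) :: real^('m::finite option)^('m option)) = 1"
proof -
  have "(\<chi> i. coords (standard_frame i) :: real^('m option)^('m option)) = mat 1"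
    by (auto simp: standard_frame_def coords_def mat_def vec_eq_iff axis_def split: option.splits)
  then show ?thesis
    by simp
qed

lemma inj_standard_frame: "inj standard_frame"
  by (rule injI) (auto simp: standard_frame_def axis_eq_axis split: option.splits)

lemma independent_standard_frame: "independent (range standard_frame)"
proof -
  have "range standard_frame \<subseteq> Basis"
    by (auto simp: standard_frame_def Basis_prod_def Basis_vec_def image_iff split: option.splits)
  then show ?thesis
    using independent_Basis independent_mono by blast
qed

lemma F_map_eq_ambient:
  "F_map \<gamma>1 \<gamma>2 = (\<lambda>x. ambient (snd x, snd x \<bullet> snd x / 2 + \<gamma>1 (fst x), \<gamma>2 (fst x)))"
  by (rule ext, rule ambient_eqI)
    (auto simp: F_map_def horizontal_def vec_eq_iff power2_norm_eq_inner split: prod.splits)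

section \<open>Tangent space, conormal and Gauss formula of the hypersurface\<close>

locale curve_graph =
  fixes I :: "real set" and U :: "(real^'m::finite) set" and \<gamma>1 \<gamma>2 :: "real \<Rightarrow> real"
  assumes open_I: "open I" and open_U: "open U"
    and smooth_\<gamma>1: "smooth_on I \<gamma>1" and smooth_\<gamma>2: "smooth_on I \<gamma>2"
    and curve_det_pos: "\<And>t. t \<in> I \<Longrightarrow> curve_det \<gamma>1 \<gamma>2 t * deriv \<gamma>2 t > 0"
begin

abbreviation M :: "(real \<times> (real^'m)) set" where
  "M \<equiv> I \<times> U"

abbreviation F :: "real \<times> (real^'m) \<Rightarrow> real^('m option option)" where
  "F \<equiv> F_map \<gamma>1 \<gamma>2"

definition D :: "real \<Rightarrow> real" where
  "D t = curve_det \<gamma>1 \<gamma>2 t / deriv \<gamma>2 t"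

text \<open>The coefficient that makes \<open>conormal\<close> vanish on the coordinate vector of
  \<open>t\<close>.\<close>

definition slope :: "real \<Rightarrow> real" where
  "slope t = deriv \<gamma>1 t / deriv \<gamma>2 t"

text \<open>The differential of \<open>F\<close> at \<open>x\<close> in closed form.\<close>

definition tangent :: "real \<times> (real^'m) \<Rightarrow> real \<times> (real^'m) \<Rightarrow> real^('m option option)" where
  "tangent x v = ambient (snd v, snd x \<bullet> snd v + deriv \<gamma>1 (fst x) * fst v, deriv \<gamma>2 (fst x) * fst v)"

text \<open>The second derivative of \<open>F\<close> at \<open>x\<close>, in closed form.\<close>

definition hess :: "real \<times> (real^'m) \<Rightarrow> real \<times> (real^'m) \<Rightarrow> real \<times> (real^'m) \<Rightarrow> real^('m option option)" where
  "hess x v w = ambient (0, snd v \<bullet> snd w + deriv (deriv \<gamma>1) (fst x) * fst v * fst w,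
     deriv (deriv \<gamma>2) (fst x) * fst v * fst w)"

text \<open>The covector annihilating the tangent space and taking the value 1 on \<open>e_n\<close>.\<close>

definition conormal :: "real \<times> (real^'m) \<Rightarrow> real^('m option option) \<Rightarrow> real" where
  "conormal x z = z $ Some None - snd x \<bullet> horizontal z - slope (fst x) * z $ None"

text \<open>A left inverse of \<open>tangent x\<close>: the last component determines the
  \<open>t\<close>-part, the horizontal component is the \<open>u\<close>-part.\<close>

definition chart :: "real \<times> (real^'m) \<Rightarrow> real^('m option option) \<Rightarrow> real \<times> (real^'m)" where
  "chart x z = (z $ None / deriv \<gamma>2 (fst x), horizontal z)"

lemma open_M: "open M"
  by (intro open_Times open_I open_U)

lemma deriv_\<gamma>2_nonzero: "t \<in> I \<Longrightarrow> deriv \<gamma>2 t \<noteq> 0"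
  using curve_det_pos by force

lemma D_pos: "t \<in> I \<Longrightarrow> D t > 0"
  using curve_det_pos[of t] by (auto simp: D_def zero_less_divide_iff zero_less_mult_iff)

lemma smooth_deriv_\<gamma>:
  "smooth_on I (deriv \<gamma>1)" "smooth_on I (deriv \<gamma>2)"
  "smooth_on I (deriv (deriv \<gamma>1))" "smooth_on I (deriv (deriv \<gamma>2))"
  using smooth_on_deriv(1)[OF open_I] smooth_\<gamma>1 smooth_\<gamma>2 by blast+

lemma smooth_D: "smooth_on I D"
proof -
  have "smooth_on I (\<lambda>t. (deriv (deriv \<gamma>1) t * deriv \<gamma>2 t + - (deriv (deriv \<gamma>2) t * deriv \<gamma>1 t)) / deriv \<gamma>2 t)"
    by (intro smooth_on_divide smooth_on_add smooth_on_mult smooth_on_minus smooth_deriv_\<gamma> open_I)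
      (rule deriv_\<gamma>2_nonzero)
  then show ?thesis
    by (simp add: D_def[abs_def] curve_det_def)
qed

lemma \<gamma>_has_derivative:
  assumes "t \<in> I"
  shows "(\<gamma>1 has_derivative (\<lambda>s. deriv \<gamma>1 t * s)) (at t)"
    and "(\<gamma>2 has_derivative (\<lambda>s. deriv \<gamma>2 t * s)) (at t)"
    and "(deriv \<gamma>1 has_derivative (\<lambda>s. deriv (deriv \<gamma>1) t * s)) (at t)"
    and "(deriv \<gamma>2 has_derivative (\<lambda>s. deriv (deriv \<gamma>2) t * s)) (at t)"
  using smooth_on_deriv(2)[OF open_I _ assms] smooth_\<gamma>1 smooth_\<gamma>2 smooth_deriv_\<gamma>
  by (auto simp: has_field_derivative_def)

lemma slope_has_derivative:
  assumes "t \<in> I"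
  shows "(slope has_derivative (\<lambda>s. D t / deriv \<gamma>2 t * s)) (at t)"
  unfolding slope_def[abs_def]
  by (rule has_derivative_eq_rhs, rule has_derivative_divide'[OF \<gamma>_has_derivative(3,4)[OF assms]])
    (use deriv_\<gamma>2_nonzero[OF assms] in \<open>auto simp: D_def curve_det_def fun_eq_iff field_simps\<close>)

lemma F_has_derivative:
  assumes "x \<in> M"
  shows "(F has_derivative tangent x) (at x)"
proof -
  have t: "fst x \<in> I"
    using assms by auto
  note g = \<gamma>_has_derivative(1,2)[OF t, THEN has_derivative_fst_compose]
  show ?thesis
    unfolding F_map_eq_ambient tangent_def[abs_def]
    by (rule bounded_linear.has_derivative[OF bounded_linear_ambient])
      (auto intro!: derivative_eq_intros g simp: inner_commute)
qed

lemma frechet_F: "x \<in> M \<Longrightarrow> frechet_derivative F (at x) = tangent x"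
  using frechet_derivative_at[OF F_has_derivative] by simp

lemma smooth_F: "smooth_on M F"
  unfolding F_map_eq_ambient divide_real_def
  by (intro smooth_on_linear[OF _ bounded_linear_ambient] smooth_on_Pair smooth_on_snd
      smooth_on_add smooth_on_ident smooth_on_mult smooth_on_inner smooth_on_const
      smooth_on_compose_fst smooth_\<gamma>1 smooth_\<gamma>2 open_I open_U open_M)

lemma tangent_linear: "linear (tangent x)"
  by (rule linearI) (auto simp: tangent_def algebra_simps intro!: ambient_eqI)

lemma conormal_linear: "linear (conormal x)"
  by (rule linearI) (auto simp: conormal_def algebra_simps)

lemma conormal_tangent [simp]: "x \<in> M \<Longrightarrow> conormal x (tangent x v) = 0"
  using deriv_\<gamma>2_nonzero[of "fst x"] by (auto simp: conormal_def tangent_def slope_def)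

lemma chart_tangent [simp]: "x \<in> M \<Longrightarrow> chart x (tangent x v) = v"
  using deriv_\<gamma>2_nonzero[of "fst x"] by (auto simp: chart_def tangent_def prod_eq_iff)

text \<open>On the kernel of the conormal \<open>chart x\<close> is also a right inverse, so this
  kernel is exactly the tangent space.\<close>

lemma tangent_chart:
  assumes "x \<in> M" "conormal x z = 0"
  shows "tangent x (chart x z) = z"
  using deriv_\<gamma>2_nonzero[of "fst x"] assms
  by (auto intro!: ambient_eqI simp: chart_def tangent_def conormal_def slope_def)

lemma immersed: "immersed_hypersurface M F"
proof -
  have "inj (frechet_derivative F (at x))" if "x \<in> M" for x
    unfolding frechet_F[OF that] by (metis chart_tangent[OF that] injI)
  then show ?thesis
    unfolding immersed_hypersurface_def using smooth_F open_M by (auto simp: card_UNIV_option)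
qed

lemma transversal_iff:
  assumes "x \<in> M"
  shows "z \<notin> range (frechet_derivative F (at x)) \<longleftrightarrow> conormal x z \<noteq> 0"
proof
  show "conormal x z \<noteq> 0" if "z \<notin> range (frechet_derivative F (at x))"
    using that tangent_chart[OF assms, of z] unfolding frechet_F[OF assms] by (metis rangeI)
  show "z \<notin> range (frechet_derivative F (at x))" if "conormal x z \<noteq> 0"
    using that assms by (auto simp: frechet_F)
qed

text \<open>Product rule for the differential of \<open>F\<close> applied to a variable field: one
  term differentiates \<open>Y\<close>, the other differentiates \<open>tangent\<close> and gives
  \<open>hess\<close>.\<close>

lemma flat_deriv_has_derivative:
  assumes "smooth_on M Y" "x \<in> M"
  shows "((\<lambda>y. frechet_derivative F (at y) (Y y)) has_derivative
    (\<lambda>v. tangent x (frechet_derivative Y (at x) v) + hess x v (Y x))) (at x)"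
proof -
  have t: "fst x \<in> I"
    using assms by auto
  note g = \<gamma>_has_derivative(3,4)[OF t, THEN has_derivative_fst_compose]
  note Y = smooth_on_has_derivative[OF assms]
  let ?dY = "frechet_derivative Y (at x)"
  have "((\<lambda>y. tangent y (Y y)) has_derivative
    (\<lambda>v. tangent x (frechet_derivative Y (at x) v) + hess x v (Y x))) (at x)"
    unfolding tangent_def[abs_def]
  proof (rule has_derivative_eq_rhs, rule bounded_linear.has_derivative[OF bounded_linear_ambient])
    show "((\<lambda>y. (snd (Y y), snd y \<bullet> snd (Y y) + deriv \<gamma>1 (fst y) * fst (Y y),
          deriv \<gamma>2 (fst y) * fst (Y y))) has_derivative
        (\<lambda>v. (snd (?dY v),
          snd x \<bullet> snd (?dY v) + snd v \<bullet> snd (Y x) +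
            (deriv \<gamma>1 (fst x) * fst (?dY v) + deriv (deriv \<gamma>1) (fst x) * fst v * fst (Y x)),
          deriv \<gamma>2 (fst x) * fst (?dY v) + deriv (deriv \<gamma>2) (fst x) * fst v * fst (Y x)))) (at x)"
      by (intro derivative_intros g Y)
  qed (auto intro!: ambient_eqI simp: fun_eq_iff hess_def)
  then show ?thesis
    by (rule has_derivative_transform_within_open[OF _ open_M assms(2)]) (simp add: frechet_F)
qed

lemma flat_deriv_eq:
  assumes "smooth_on M Y" "x \<in> M"
  shows "flat_deriv F X Y x = tangent x (frechet_derivative Y (at x) (X x)) + hess x (X x) (Y x)"
  unfolding flat_deriv_def frechet_derivative_at[OF flat_deriv_has_derivative[OF assms], symmetric] ..

text \<open>Here \<open>curve_det\<close> enters: the second derivative of \<open>\<gamma>1\<close>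
  minus \<open>slope\<close> times that of \<open>\<gamma>2\<close> equals \<open>D\<close>.\<close>

lemma conormal_hess:
  assumes "x \<in> M"
  shows "conormal x (hess x v w) = D (fst x) * fst v * fst w + snd v \<bullet> snd w"
  using deriv_\<gamma>2_nonzero[of "fst x"] assms
  by (auto simp: conormal_def hess_def D_def slope_def curve_det_def field_simps)

context
  fixes \<xi> x
  assumes x: "x \<in> M" and nz: "conormal x (\<xi> x) \<noteq> 0"
begin

text \<open>The conormal kills the tangential term and so yields \<open>c\<close>; after subtracting
  \<open>c *\<^sub>R \<xi> x\<close>, the left inverse \<open>chart x\<close> yields
  \<open>v\<close>. These are the values of the two \<open>THE\<close> terms.\<close>

lemma decomposition_unique:
  assumes "z = frechet_derivative F (at x) v + c *\<^sub>R \<xi> x"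
  shows "c = conormal x z / conormal x (\<xi> x)"
    and "v = chart x (z - (conormal x z / conormal x (\<xi> x)) *\<^sub>R \<xi> x)"
proof -
  show c: "c = conormal x z / conormal x (\<xi> x)"
    using nz x unfolding assms frechet_F[OF x]
    by (simp add: linear_add[OF conormal_linear] linear_scale[OF conormal_linear])
  show "v = chart x (z - (conormal x z / conormal x (\<xi> x)) *\<^sub>R \<xi> x)"
    unfolding c[symmetric] using x by (simp add: assms frechet_F)
qed

lemma decomposition_exists:
  "z = frechet_derivative F (at x) (chart x (z - (conormal x z / conormal x (\<xi> x)) *\<^sub>R \<xi> x))
     + (conormal x z / conormal x (\<xi> x)) *\<^sub>R \<xi> x"
proof -
  have "conormal x (z - (conormal x z / conormal x (\<xi> x)) *\<^sub>R \<xi> x) = 0"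
    using nz by (simp add: linear_diff[OF conormal_linear] linear_scale[OF conormal_linear])
  then show ?thesis
    by (simp add: frechet_F[OF x] tangent_chart[OF x])
qed

lemma transversal_part_eq: "transversal_part F \<xi> x z = conormal x z / conormal x (\<xi> x)"
  unfolding transversal_part_def
proof (rule the_equality)
  show "\<exists>v. z = frechet_derivative F (at x) v + (conormal x z / conormal x (\<xi> x)) *\<^sub>R \<xi> x"
    by (rule exI) (rule decomposition_exists)
qed (elim exE, rule decomposition_unique(1))

lemma tangential_part_eq:
  "tangential_part F \<xi> x z = chart x (z - (conormal x z / conormal x (\<xi> x)) *\<^sub>R \<xi> x)"
  unfolding tangential_part_def
proof (rule the_equality)
  show "\<exists>c. z = frechet_derivative F (at x)
      (chart x (z - (conormal x z / conormal x (\<xi> x)) *\<^sub>R \<xi> x)) + c *\<^sub>R \<xi> x"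
    by (rule exI) (rule decomposition_exists)
qed (elim exE, rule decomposition_unique(2))

text \<open>The left side is the expanded derivative, the form in which a row appears when the
  volume determinant is differentiated.\<close>

lemma gauss_formula:
  assumes "smooth_on M Y"
  shows "tangent x (frechet_derivative Y (at x) (X x)) + hess x (X x) (Y x)
    = tangent x (induced_conn F \<xi> X Y x)
      + (conormal x (flat_deriv F X Y x) / conormal x (\<xi> x)) *\<^sub>R \<xi> x"
  unfolding induced_conn_def tangential_part_eq
  by (rule trans[OF flat_deriv_eq[OF assms x, symmetric]])
    (rule decomposition_exists[of "flat_deriv F X Y x", unfolded frechet_F[OF x]])

lemma second_form_eq:
  "second_form F \<xi> x v w = (D (fst x) * fst v * fst w + snd v \<bullet> snd w) / conormal x (\<xi> x)"
  unfolding second_form_def transversal_part_eq flat_deriv_eq[OF smooth_on_const x]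
  using x by (simp add: linear_add[OF conormal_linear] conormal_hess linear_0[OF tangent_linear])

lemma induced_conn_const:
  "induced_conn F \<xi> (\<lambda>_. v) (\<lambda>_. w) x =
    chart x (hess x v w - ((D (fst x) * fst v * fst w + snd v \<bullet> snd w) / conormal x (\<xi> x)) *\<^sub>R \<xi> x)"
  unfolding induced_conn_def tangential_part_eq flat_deriv_eq[OF smooth_on_const x]
  using x by (simp add: conormal_hess linear_0[OF tangent_linear])

end


section \<open>The affine normal\<close>

text \<open>The transversal entry is left free so that a derivative of \<open>\<xi>\<close> can take
  the place of \<open>\<xi>\<close>.\<close>

definition volume_form ::
  "real \<times> (real^'m) \<Rightarrow> ('m option \<Rightarrow> real \<times> (real^'m)) \<Rightarrow> real^('m option option) \<Rightarrow> real" where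
  "volume_form x X z = det (\<chi> k. case k of Some i \<Rightarrow> tangent x (X i) | None \<Rightarrow> z)"

text \<open>Replacing the \<open>e_n\<close>-column by the conormal leaves a single nonzero entry in it.\<close>

lemma volume_form_eq:
  assumes "x \<in> M"
  shows "volume_form x X z = - (conormal x z * (deriv \<gamma>2 (fst x) * det (\<chi> i. coords (X i))))"
proof -
  define A where "A = (\<chi> k. case k of Some i \<Rightarrow> tangent x (X i) | None \<Rightarrow> z)"
  let ?B = "transpose A"
  let ?n = "Some None :: 'm option option"
  \<comment> \<open>The columns of \<open>A\<close> are handled as rows of its transpose. Adding
    \<open>w\<close> to the \<open>e_n\<close>-column subtracts the other columns with the
    coefficients of the conormal, which turns each entry into the conormal of its row.\<close>
  define w where "w = - ((\<Sum>k\<in>UNIV. (snd x $ k) *s row (Some (Some k)) ?B) + slope (fst x) *s row None ?B)"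
  have "row (Some (Some k)) ?B \<in> vec.span {row j ?B | j. j \<noteq> ?n}" for k
    by (rule vec.span_base) blast
  moreover have "row None ?B \<in> vec.span {row j ?B | j. j \<noteq> ?n}"
    by (rule vec.span_base) blast
  ultimately have "w \<in> vec.span {row j ?B | j. j \<noteq> ?n}"
    unfolding w_def by (intro vec.span_neg vec.span_add vec.span_sum vec.span_scale) auto
  from det_row_span[OF this]
  have "det A = det (\<chi> j. if j = ?n then row ?n ?B + w else row j ?B)"
    by (simp add: det_transpose)
  also have "(\<chi> j. if j = ?n then row ?n ?B + w else row j ?B)
      = transpose (\<chi> i j. if j = ?n then conormal x (A $ i) else A $ i $ j)" (is "_ = transpose ?A'")
    by (auto simp: vec_eq_iff w_def row_def transpose_def conormal_def inner_vec_def horizontal_def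
        sum_negf)
  also have "det (transpose ?A') = det ?A'"
    by (rule det_transpose)
  \<comment> \<open>Exchanging the columns \<open>Some None\<close> and \<open>None\<close> moves
    the conormal column to where \<open>det_option_column\<close> expands; this is the source of the
    minus sign.\<close>
  also have "\<dots> = - det (\<chi> i j. ?A' $ i $ Transposition.transpose ?n None j)"
  proof -
    have "Transposition.transpose ?n None permutes UNIV"
      by (rule permutes_swap_id) auto
    from det_permute_columns[OF this, of ?A'] show ?thesis
      by (simp add: sign_swap_id)
  qed
  also have "(\<chi> i j. ?A' $ i $ Transposition.transpose ?n None j)
      = (\<chi> i j. if j = None then conormal x (A $ i) else if j = ?n then A $ i $ None else A $ i $ j)"
    by (auto simp: vec_eq_iff Transposition.transpose_def)
  also have "det \<dots> = conormal x z * det (\<chi> i j. case j of Some k \<Rightarrow> snd (X i) $ k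
      | None \<Rightarrow> deriv \<gamma>2 (fst x) * fst (X i))"
  proof (subst det_option_column)
    fix i
    show "(\<chi> i j. if j = None then conormal x (A $ i) else if j = ?n then A $ i $ None else A $ i $ j)
        $ Some i $ None = 0"
      by (simp add: A_def assms)
  next
    have "(\<chi> i j. (\<chi> i j. if j = None then conormal x (A $ i) else if j = ?n then A $ i $ None
          else A $ i $ j) $ Some i $ Some j)
        = (\<chi> i j. case j of Some k \<Rightarrow> snd (X i) $ k | None \<Rightarrow> deriv \<gamma>2 (fst x) * fst (X i))"
      by (auto simp: vec_eq_iff A_def tangent_def split: option.split)
    then show "(\<chi> i j. if j = None then conormal x (A $ i) else if j = ?n then A $ i $ None else A $ i $ j)
        $ None $ None * det (\<chi> i j. (\<chi> i j. if j = None then conormal x (A $ i) else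
        if j = ?n then A $ i $ None else A $ i $ j) $ Some i $ Some j)
        = conormal x z * det (\<chi> i j. case j of Some k \<Rightarrow> snd (X i) $ k
          | None \<Rightarrow> deriv \<gamma>2 (fst x) * fst (X i))"
      by (simp add: A_def)
  qed
  finally show ?thesis
    by (simp add: det_frame_columns volume_form_def A_def)
qed

lemma induced_volume_eq_volume_form:
  "x \<in> M \<Longrightarrow> induced_volume F \<xi> x X = volume_form x X (\<xi> x)"
  by (simp only: induced_volume_def volume_form_def frechet_F)

text \<open>In coordinates \<open>h\<close> is diagonal, with one entry \<open>D / c\<close> and
  \<open>CARD('m)\<close> entries \<open>1 / c\<close>, where \<open>c\<close> is the conormal of
  \<open>\<xi>\<close>; the determinant is that of a Gram matrix.\<close>

lemma det_second_form:
  assumes "x \<in> M" "conormal x (\<xi> x) \<noteq> 0"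
  shows "det (\<chi> i j. second_form F \<xi> x (X i) (X j))
    = D (fst x) / conormal x (\<xi> x) ^ (CARD('m) + 1) * (det (\<chi> i. coords (X i)))\<^sup>2"
proof -
  let ?c = "conormal x (\<xi> x)" and ?C = "(\<chi> i. coords (X i)) :: real^('m option)^('m option)"
  let ?g = "\<lambda>k :: 'm option. (case k of None \<Rightarrow> D (fst x) | Some _ \<Rightarrow> 1) / ?c"
  have "second_form F \<xi> x (X i) (X j) = (\<Sum>k\<in>UNIV. ?C $ i $ k * (?g k * ?C $ j $ k))" for i j
    by (simp add: second_form_eq[where \<xi> = \<xi>, OF assms] UNIV_option_conv sum.reindex inner_vec_def
        add_divide_distrib sum_divide_distrib)
  then have "det (\<chi> i j. second_form F \<xi> x (X i) (X j)) = prod ?g UNIV * (det ?C)\<^sup>2"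
    using det_gram[of ?C ?g] by simp
  moreover have "prod ?g UNIV = D (fst x) / ?c ^ (CARD('m) + 1)"
    by (simp add: UNIV_option_conv prod.reindex power_one_over divide_simps)
  ultimately show ?thesis
    by simp
qed

text \<open>Differentiating the rows of the determinant and inserting the Gauss formula leaves only the
  transversal part of \<open>D_Z \<xi>\<close>, that is \<open>\<nabla>\<omega> = \<tau> \<otimes> \<omega>\<close>.\<close>

lemma volume_derivative:
  assumes x: "x \<in> M" and nz: "conormal x (\<xi> x) \<noteq> 0"
    and \<xi>: "smooth_on M \<xi>" and X: "\<And>i. smooth_on M (X i)"
  shows "frechet_derivative (\<lambda>y. induced_volume F \<xi> y (\<lambda>i. X i y)) (at x) (Z x) =
      (\<Sum>i\<in>UNIV. induced_volume F \<xi> x ((\<lambda>j. X j x)(i := induced_conn F \<xi> Z (X i) x)))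
      + volume_form x (\<lambda>i. X i x) (frechet_derivative \<xi> (at x) (Z x))"
proof -
  define f where "f = (\<lambda>k y. case k of Some i \<Rightarrow> frechet_derivative F (at y) (X i y) | None \<Rightarrow> \<xi> y)"
  define f' where "f' = (\<lambda>k v. case k of
      Some i \<Rightarrow> tangent x (frechet_derivative (X i) (at x) v) + hess x v (X i x)
    | None \<Rightarrow> frechet_derivative \<xi> (at x) v)"
  have "(f k has_derivative f' k) (at x)" for k
    using flat_deriv_has_derivative[OF X x] smooth_on_has_derivative[OF \<xi> x]
    by (cases k) (auto simp: f_def f'_def)
  from has_derivative_det[OF this]
  have "frechet_derivative (\<lambda>y. det (\<chi> k. f k y)) (at x)
      = (\<lambda>v. \<Sum>k\<in>UNIV. det (\<chi> i. if i = k then f' k v else f i x))"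
    by (rule frechet_derivative_at[symmetric])
  moreover have "(\<lambda>y. det (\<chi> k. f k y)) = (\<lambda>y. induced_volume F \<xi> y (\<lambda>i. X i y))"
    by (simp add: induced_volume_def f_def)
  moreover have "det (\<chi> i. if i = Some l then f' (Some l) (Z x) else f i x)
      = induced_volume F \<xi> x ((\<lambda>j. X j x)(l := induced_conn F \<xi> Z (X l) x))" for l
  proof -
    let ?Y = "(\<lambda>j. X j x)(l := induced_conn F \<xi> Z (X l) x)"
    let ?A = "(\<chi> k. case k of Some i \<Rightarrow> frechet_derivative F (at x) (?Y i) | None \<Rightarrow> \<xi> x)"
    let ?c = "conormal x (flat_deriv F Z (X l) x) / conormal x (\<xi> x)"
    have "f' (Some l) (Z x) = tangent x (induced_conn F \<xi> Z (X l) x) + ?c *\<^sub>R \<xi> x"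
      unfolding f'_def option.case by (rule gauss_formula[where \<xi> = \<xi> and X = Z, OF x nz X])
    \<comment> \<open>The transversal part of the differentiated row is a multiple of the row
      \<open>None\<close>, so removing it is a row operation that preserves the determinant.\<close>
    then have "(\<chi> i. if i = Some l then f' (Some l) (Z x) else f i x)
        = (\<chi> k. if k = Some l then row (Some l) ?A + ?c *s row None ?A else row k ?A)"
      using x by (auto simp: vec_eq_iff row_def f_def frechet_F split: option.split)
    then show ?thesis
      unfolding induced_volume_def by (simp only: det_row_operation[of "Some l" None] option.distinct not_False_eq_True)
  qed
  moreover have "det (\<chi> i. if i = None then f' None (Z x) else f i x)
      = volume_form x (\<lambda>i. X i x) (frechet_derivative \<xi> (at x) (Z x))"
    unfolding volume_form_def f_def f'_def using x
    by (intro arg_cong[of _ _ det]) (auto simp: vec_eq_iff frechet_F split: option.split)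
  ultimately show ?thesis
    by (simp add: sum_UNIV_option)
qed

text \<open>The positive root of order n+2, where \<open>CARD('m)\<close> is n-1. Writing it with
  \<open>powr\<close> gives smoothness, since the base is positive on \<open>I\<close>.\<close>

definition mu :: "real \<Rightarrow> real" where
  "mu t = (D t / (deriv \<gamma>2 t)\<^sup>2) powr (1 / (CARD('m) + 3))"

text \<open>The differential equation of the theorem, solved for its coefficient.\<close>

definition nu :: "real \<Rightarrow> real" where
  "nu t = - deriv mu t / D t"

abbreviation \<xi>\<^sub>0 :: "real \<times> (real^'m) \<Rightarrow> real^('m option option)" where
  "\<xi>\<^sub>0 \<equiv> normal_field \<gamma>1 \<gamma>2 mu nu"

lemma mu_base_pos: "t \<in> I \<Longrightarrow> D t / (deriv \<gamma>2 t)\<^sup>2 > 0"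
  using D_pos deriv_\<gamma>2_nonzero by simp

lemma mu_pos: "t \<in> I \<Longrightarrow> mu t > 0"
  using mu_base_pos unfolding mu_def by (metis less_irrefl powr_gt_zero)

lemma mu_power:
  assumes "t \<in> I"
  shows "mu t ^ (CARD('m) + 3) = D t / (deriv \<gamma>2 t)\<^sup>2"
proof -
  have "mu t ^ (CARD('m) + 3) = mu t powr real (CARD('m) + 3)"
    by (rule powr_realpow[OF mu_pos[OF assms], symmetric])
  also have "\<dots> = D t / (deriv \<gamma>2 t)\<^sup>2"
    using mu_base_pos[OF assms] D_pos[OF assms] by (simp add: mu_def powr_powr add.commute)
  finally show ?thesis .
qed

lemma smooth_mu: "smooth_on I mu"
  unfolding mu_def[abs_def] power2_eq_square
  by (intro smooth_on_powr smooth_on_divide smooth_on_mult smooth_D smooth_deriv_\<gamma> open_I)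
    (use deriv_\<gamma>2_nonzero mu_base_pos in \<open>auto simp: power2_eq_square\<close>)

lemma smooth_nu: "smooth_on I nu"
  unfolding nu_def[abs_def]
  by (intro smooth_on_divide smooth_on_minus smooth_D smooth_on_deriv(1) smooth_mu open_I)
    (use D_pos in force)

lemma deriv_mu: "t \<in> I \<Longrightarrow> deriv mu t = - nu t * D t"
  using D_pos[of t] by (simp add: nu_def)

lemma normal_field_eq:
  assumes "x \<in> M"
  shows "\<xi>\<^sub>0 x = ambient (0, mu (fst x) + nu (fst x) * deriv \<gamma>1 (fst x), nu (fst x) * deriv \<gamma>2 (fst x))"
proof -
  obtain t u where x: "x = (t, u)" and t: "t \<in> I"
    using assms by auto
  have "((\<lambda>s. F (s, u)) has_derivative (\<lambda>s. s *\<^sub>R ambient (0, deriv \<gamma>1 t, deriv \<gamma>2 t))) (at t)"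
    unfolding F_map_eq_ambient fst_conv snd_conv
  proof (rule has_derivative_eq_rhs, rule bounded_linear.has_derivative[OF bounded_linear_ambient])
    show "((\<lambda>s. (u, u \<bullet> u / 2 + \<gamma>1 s, \<gamma>2 s)) has_derivative
        (\<lambda>s. (0, 0 + deriv \<gamma>1 t * s, deriv \<gamma>2 t * s))) (at t)"
      by (intro derivative_intros \<gamma>_has_derivative[OF t])
  qed (auto intro!: ambient_eqI simp: fun_eq_iff)
  then have "vector_derivative (\<lambda>s. F (s, u)) (at t) = ambient (0, deriv \<gamma>1 t, deriv \<gamma>2 t)"
    by (intro vector_derivative_at) (simp only: has_vector_derivative_def)
  then show ?thesis
    by (auto simp: normal_field_def x axis_eq_ambient intro!: ambient_eqI)
qed

text \<open>The covector itself varies with the point: its \<open>u\<close>-coefficients and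
  \<open>slope\<close> contribute the last two terms. Once both \<open>conormal y (\<xi> y)\<close>
  and the conormal of the derivative of \<open>\<xi>\<close> are known, these terms determine
  components of \<open>\<xi>\<close>.\<close>

lemma conormal_field_derivative:
  assumes "smooth_on M \<xi>" "x \<in> M"
  shows "((\<lambda>y. conormal y (\<xi> y)) has_derivative
    (\<lambda>v. conormal x (frechet_derivative \<xi> (at x) v) - snd v \<bullet> horizontal (\<xi> x)
      - D (fst x) / deriv \<gamma>2 (fst x) * fst v * \<xi> x $ None)) (at x)"
proof -
  have t: "fst x \<in> I"
    using assms by auto
  note \<xi> = smooth_on_has_derivative[OF assms]
  let ?d = "frechet_derivative \<xi> (at x)"
  note n = bounded_linear.has_derivative[OF bounded_linear_vec_nth \<xi>]
  note h = bounded_linear.has_derivative[OF bounded_linear_horizontal \<xi>]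
  note s = slope_has_derivative[OF t, THEN has_derivative_fst_compose]
  show ?thesis
    unfolding conormal_def
  proof (rule has_derivative_eq_rhs)
    show "((\<lambda>y. \<xi> y $ Some None - snd y \<bullet> horizontal (\<xi> y) - slope (fst y) * \<xi> y $ None) has_derivative
      (\<lambda>v. ?d v $ Some None - (snd x \<bullet> horizontal (?d v) + snd v \<bullet> horizontal (\<xi> x)) -
        (slope (fst x) * ?d v $ None + D (fst x) / deriv \<gamma>2 (fst x) * fst v * \<xi> x $ None))) (at x)"
      by (intro derivative_intros n h s)
  qed (simp add: fun_eq_iff)
qed

section \<open>Characterisation of the affine normal by the conormal\<close>

lemma mu_fst_derivative:
  assumes "x \<in> M"
  shows "((\<lambda>y. mu (fst y)) has_derivative (\<lambda>v. - nu (fst x) * D (fst x) * fst v)) (at x)"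
proof -
  have t: "fst x \<in> I"
    using assms by auto
  have "(mu has_derivative (\<lambda>s. - nu (fst x) * D (fst x) * s)) (at (fst x))"
    using smooth_on_deriv(2)[OF open_I smooth_mu t] unfolding deriv_mu[OF t] has_field_derivative_def .
  then show ?thesis
    by (rule has_derivative_fst_compose)
qed

text \<open>The metric normalisation fixes the conormal of \<open>\<xi>\<close> up to sign and
  positivity of \<open>h\<close> fixes the sign; parallel volume then forces the remaining term of
  \<open>volume_derivative\<close> to vanish.\<close>

lemma convex_affine_normal_imp_conormal:
  assumes "convex_affine_normal M F \<xi>"
  shows "smooth_on M \<xi>"
    and "\<And>x. x \<in> M \<Longrightarrow> conormal x (\<xi> x) = mu (fst x)"
    and "\<And>x v. x \<in> M \<Longrightarrow> conormal x (frechet_derivative \<xi> (at x) v) = 0"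
proof -
  note defs = convex_affine_normal_def affine_normal_def transversal_field_def
  show \<xi>: "smooth_on M \<xi>"
    using assms by (simp add: defs)
  have nz: "conormal x (\<xi> x) \<noteq> 0" if "x \<in> M" for x
    using assms that transversal_iff[OF that] unfolding defs by blast
  show "conormal x (\<xi> x) = mu (fst x)" if x: "x \<in> M" for x
  proof -
    let ?c = "conormal x (\<xi> x)" and ?a = "deriv \<gamma>2 (fst x)"
    have t: "fst x \<in> I"
      using x by auto
    \<comment> \<open>On this vector \<open>h\<close> equals \<open>D\<close> divided by the
      conormal of \<open>\<xi>\<close>, so positivity of \<open>h\<close> makes that conormal
      positive.\<close>
    have "second_form F \<xi> x (1, 0) (1, 0) > 0"
      using assms x by (auto simp: convex_affine_normal_def pos_definite_def prod_eq_iff)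
    then have c: "?c > 0"
      using D_pos[OF t] by (simp add: second_form_eq[where \<xi> = \<xi>, OF x nz[OF x]] zero_less_divide_iff)
    have "(induced_volume F \<xi> x standard_frame)\<^sup>2
        = \<bar>det (\<chi> i j. second_form F \<xi> x (standard_frame i) (standard_frame j))\<bar>"
      using assms x inj_standard_frame independent_standard_frame unfolding defs by blast
    then have "(?c * ?a)\<^sup>2 = D (fst x) / ?c ^ (CARD('m) + 1)"
      using D_pos[OF t] c
      by (simp add: induced_volume_eq_volume_form[OF x] volume_form_eq[OF x]
          det_second_form[where \<xi> = \<xi>, OF x nz[OF x]] det_standard_frame)
    \<comment> \<open>Two factors \<open>?c\<close> come from the squared volume and
      \<open>CARD('m) + 1\<close> from the determinant of \<open>h\<close>, which gives the exponent
      n+2.\<close>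
    then have "?c ^ (CARD('m) + 3) = D (fst x) / ?a\<^sup>2"
      using c deriv_\<gamma>2_nonzero[OF t] by (simp add: field_simps power2_eq_square eval_nat_numeral)
    then have "?c ^ (CARD('m) + 3) = mu (fst x) ^ (CARD('m) + 3)"
      by (simp only: mu_power[OF t])
    then show ?thesis
      by (rule power_eq_imp_eq_base) (use c mu_pos[OF t] in auto)
  qed
  show "conormal x (frechet_derivative \<xi> (at x) v) = 0" if x: "x \<in> M" for x v
  proof -
    have t: "fst x \<in> I"
      using x by auto
    have "volume_parallel M F \<xi>"
      using assms by (simp add: defs)
    then have "frechet_derivative (\<lambda>y. induced_volume F \<xi> y standard_frame) (at x) v =
        (\<Sum>i\<in>UNIV. induced_volume F \<xi> x
          (standard_frame(i := induced_conn F \<xi> (\<lambda>_. v) (\<lambda>_. standard_frame i) x)))"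
      unfolding volume_parallel_def using x smooth_on_const
      by (elim allE[of _ "\<lambda>_. v"] allE[of _ "\<lambda>i _. standard_frame i"]) auto
    moreover have "frechet_derivative (\<lambda>y. induced_volume F \<xi> y standard_frame) (at x) v =
        (\<Sum>i\<in>UNIV. induced_volume F \<xi> x
          (standard_frame(i := induced_conn F \<xi> (\<lambda>_. v) (\<lambda>_. standard_frame i) x)))
        + volume_form x standard_frame (frechet_derivative \<xi> (at x) v)"
      using volume_derivative[where \<xi> = \<xi> and X = "\<lambda>i _. standard_frame i" and Z = "\<lambda>_. v",
          OF x nz[OF x] \<xi> smooth_on_const] .
    ultimately have "volume_form x standard_frame (frechet_derivative \<xi> (at x) v) = 0"
      by simp
    then show ?thesis
      using deriv_\<gamma>2_nonzero[OF t] by (simp add: volume_form_eq[OF x] det_standard_frame)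
  qed
qed

lemma second_form_pos:
  assumes "x \<in> M" "conormal x (\<xi> x) > 0"
  shows "pos_definite (second_form F \<xi> x)"
  unfolding pos_definite_def
proof (intro allI impI)
  fix v :: "real \<times> (real^'m)"
  assume "v \<noteq> 0"
  have d: "D (fst x) > 0"
    using assms D_pos by auto
  have "D (fst x) * (fst v)\<^sup>2 + snd v \<bullet> snd v > 0"
  proof (cases "snd v = 0")
    case True
    with \<open>v \<noteq> 0\<close> have "fst v \<noteq> 0"
      by (auto simp: prod_eq_iff)
    with True d show ?thesis
      by simp
  next
    case False
    with d show ?thesis
      by (simp add: add_nonneg_pos)
  qed
  then show "second_form F \<xi> x v v > 0"
    using assms by (simp add: second_form_eq[where \<xi> = \<xi>, OF assms(1)] power2_eq_square mult.assoc)
qed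

text \<open>Both sides of the metric normalisation carry the factor
  \<open>(det (\<chi> i. coords (X i)))\<^sup>2\<close>, so for every frame it reduces to the power
  equation for \<open>mu\<close>.\<close>

lemma conormal_imp_convex_affine_normal:
  assumes \<xi>: "smooth_on M \<xi>"
    and c: "\<And>x. x \<in> M \<Longrightarrow> conormal x (\<xi> x) = mu (fst x)"
    and d: "\<And>x v. x \<in> M \<Longrightarrow> conormal x (frechet_derivative \<xi> (at x) v) = 0"
  shows "convex_affine_normal M F \<xi>"
proof -
  have pos: "conormal x (\<xi> x) > 0" if "x \<in> M" for x
    using c[OF that] mu_pos[of "fst x"] that by auto
  then have nz: "conormal x (\<xi> x) \<noteq> 0" if "x \<in> M" for x
    using that by force
  have pd: "pos_definite (second_form F \<xi> x)" if "x \<in> M" for x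
    by (intro second_form_pos that pos)
  then have "nondegenerate (second_form F \<xi> x)" if "x \<in> M" for x
    using that unfolding pos_definite_def nondegenerate_def by (metis less_irrefl)
  moreover have "transversal_field M F \<xi>"
    unfolding transversal_field_def using \<xi> transversal_iff nz by blast
  moreover have "volume_parallel M F \<xi>"
    unfolding volume_parallel_def
  proof (intro allI impI ballI)
    fix Z :: "real \<times> (real^'m) \<Rightarrow> real \<times> (real^'m)" and X :: "'m option \<Rightarrow> real \<times> (real^'m) \<Rightarrow> real \<times> (real^'m)" and x
    assume "smooth_on M Z \<and> (\<forall>i. smooth_on M (X i))" and x: "x \<in> M"
    then have X: "smooth_on M (X i)" for i
      by simp
    show "frechet_derivative (\<lambda>y. induced_volume F \<xi> y (\<lambda>i. X i y)) (at x) (Z x) =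
      (\<Sum>i\<in>UNIV. induced_volume F \<xi> x ((\<lambda>j. X j x)(i := induced_conn F \<xi> Z (X i) x)))"
      using volume_derivative[where \<xi> = \<xi> and X = X and Z = Z, OF x nz[OF x] \<xi> X]
      by (simp add: volume_form_eq[OF x] d[OF x])
  qed
  moreover have "(induced_volume F \<xi> x X)\<^sup>2 = \<bar>det (\<chi> i j. second_form F \<xi> x (X i) (X j))\<bar>"
    if x: "x \<in> M" for x and X :: "'m option \<Rightarrow> _"
  proof -
    let ?m = "mu (fst x)" and ?a = "deriv \<gamma>2 (fst x)"
    have t: "fst x \<in> I"
      using x by auto
    have "?m ^ (CARD('m) + 3) * ?a\<^sup>2 = D (fst x)"
      using mu_power[OF t] deriv_\<gamma>2_nonzero[OF t] by (simp add: field_simps)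
    then have "(?m * ?a)\<^sup>2 = D (fst x) / ?m ^ (CARD('m) + 1)"
      using mu_pos[OF t] by (simp add: field_simps power2_eq_square eval_nat_numeral)
    moreover have "D (fst x) / ?m ^ (CARD('m) + 1) > 0"
      using mu_pos[OF t] D_pos[OF t] by simp
    ultimately show ?thesis
      unfolding det_second_form[where \<xi> = \<xi>, OF x nz[OF x]] induced_volume_eq_volume_form[OF x]
        volume_form_eq[OF x] c[OF x]
      by (simp only: abs_mult abs_of_pos power2_minus power_mult_distrib abs_power2 mult.assoc[symmetric])
  qed
  ultimately show ?thesis
    unfolding convex_affine_normal_def affine_normal_def using immersed pd by simp
qed

text \<open>The function \<open>conormal y (\<xi> y) = mu (fst y)\<close> has two expressions for
  its derivative. Comparing them determines \<open>\<xi>\<close> in one direction and shows that the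
  conormal of its derivative vanishes in the other.\<close>

lemma convex_affine_normal_iff:
  "convex_affine_normal M F \<xi> \<longleftrightarrow> (\<forall>x\<in>M. \<xi> x = \<xi>\<^sub>0 x)"
proof (intro iffI ballI)
  fix x
  assume an: "convex_affine_normal M F \<xi>" and x: "x \<in> M"
  note c = convex_affine_normal_imp_conormal[OF an]
  have t: "fst x \<in> I"
    using x by auto
  have "((\<lambda>y. conormal y (\<xi> y)) has_derivative (\<lambda>v. - nu (fst x) * D (fst x) * fst v)) (at x)"
    by (rule has_derivative_transform_within_open[OF mu_fst_derivative[OF x] open_M x])
      (simp add: c(2))
  from has_derivative_unique[OF conormal_field_derivative[OF c(1) x] this]
  have eq: "- (snd v \<bullet> horizontal (\<xi> x)) - D (fst x) / deriv \<gamma>2 (fst x) * fst v * \<xi> x $ None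
      = - nu (fst x) * D (fst x) * fst v" for v
    by (simp add: c(3)[OF x] fun_eq_iff prod_eq_iff split_paired_all)
  \<comment> \<open>In this direction the identity says that minus the squared length of
    \<open>horizontal (\<xi> x)\<close> is 0.\<close>
  have h: "horizontal (\<xi> x) = 0"
    using eq[of "(0, horizontal (\<xi> x))"] by simp
  have n: "\<xi> x $ None = nu (fst x) * deriv \<gamma>2 (fst x)"
    using eq[of "(1, 0)"] D_pos[OF t] deriv_\<gamma>2_nonzero[OF t] by (simp add: field_simps)
  show "\<xi> x = \<xi>\<^sub>0 x"
    using c(2)[OF x] deriv_\<gamma>2_nonzero[OF t]
    by (auto simp: normal_field_eq[OF x] h n conormal_def slope_def algebra_simps intro!: ambient_eqI)
next
  assume eq: "\<forall>x\<in>M. \<xi> x = \<xi>\<^sub>0 x"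
  \<comment> \<open>Smoothness is read off the closed formula and transferred to
    \<open>\<xi>\<close>, which agrees with it on the open set \<open>M\<close>.\<close>
  let ?f = "\<lambda>x. ambient (0, mu (fst x) + nu (fst x) * deriv \<gamma>1 (fst x), nu (fst x) * deriv \<gamma>2 (fst x))"
  have "smooth_on M ?f"
    by (intro smooth_on_linear[OF _ bounded_linear_ambient] smooth_on_Pair smooth_on_add
        smooth_on_mult smooth_on_const smooth_on_compose_fst smooth_mu smooth_nu smooth_deriv_\<gamma>
        open_I open_U open_M)
  then have \<xi>: "smooth_on M \<xi>"
    by (rule iffD1[OF smooth_on_cong[OF open_M], rotated]) (simp add: eq normal_field_eq)
  have c: "conormal x (\<xi> x) = mu (fst x)" if "x \<in> M" for x
    using deriv_\<gamma>2_nonzero[of "fst x"] that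
    by (auto simp: eq normal_field_eq conormal_def slope_def)
  have "conormal x (frechet_derivative \<xi> (at x) v) = 0" if x: "x \<in> M" for x v
  proof -
    have "((\<lambda>y. conormal y (\<xi> y)) has_derivative (\<lambda>v. - nu (fst x) * D (fst x) * fst v)) (at x)"
      by (rule has_derivative_transform_within_open[OF mu_fst_derivative[OF x] open_M x])
        (simp add: c)
    from fun_cong[OF has_derivative_unique[OF conormal_field_derivative[OF \<xi> x] this], of v]
    show ?thesis
      using deriv_\<gamma>2_nonzero[of "fst x"] x by (auto simp: eq normal_field_eq)
  qed
  then show "convex_affine_normal M F \<xi>"
    using conormal_imp_convex_affine_normal \<xi> c by blast
qed

end


section \<open>The Levi-Civita connection and the symmetry\<close>

text \<open>The Christoffel symbols of the warped metric \<open>P(t) dt\<^sup>2 + Q(t) |du|\<^sup>2\<close>.\<close>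

definition christoffel ::
  "(real \<Rightarrow> real) \<Rightarrow> (real \<Rightarrow> real) \<Rightarrow> real \<times> 'b::euclidean_space \<Rightarrow> real \<times> 'b \<Rightarrow> real \<times> 'b \<Rightarrow> real \<times> 'b" where
  "christoffel P Q x v w =
     (deriv P (fst x) / (2 * P (fst x)) * (fst v * fst w)
        - deriv Q (fst x) / (2 * P (fst x)) * (snd v \<bullet> snd w),
      (deriv Q (fst x) / (2 * Q (fst x))) *\<^sub>R (fst v *\<^sub>R snd w + fst w *\<^sub>R snd v))"

definition warped_conn ::
  "(real \<Rightarrow> real) \<Rightarrow> (real \<Rightarrow> real) \<Rightarrow> (real \<times> 'b::euclidean_space \<Rightarrow> real \<times> 'b) \<Rightarrow>
    (real \<times> 'b \<Rightarrow> real \<times> 'b) \<Rightarrow> real \<times> 'b \<Rightarrow> real \<times> 'b" where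
  "warped_conn P Q X Y x = frechet_derivative Y (at x) (X x) + christoffel P Q x (X x) (Y x)"

lemma christoffel_simps:
  "christoffel P Q x (v + v') w = christoffel P Q x v w + christoffel P Q x v' w"
  "christoffel P Q x v (w + w') = christoffel P Q x v w + christoffel P Q x v w'"
  "christoffel P Q x (c *\<^sub>R v) w = c *\<^sub>R christoffel P Q x v w"
  "christoffel P Q x v (c *\<^sub>R w) = c *\<^sub>R christoffel P Q x v w"
  by (auto simp: christoffel_def prod_eq_iff algebra_simps inner_add_left inner_add_right
      add_divide_distrib)

lemma christoffel_commute: "christoffel P Q x v w = christoffel P Q x w v"
  by (simp add: christoffel_def mult.commute inner_commute add.commute)

text \<open>Torsion vanishes because \<open>christoffel\<close> is symmetric in its arguments; in
  the metric identity its coefficients reproduce the derivatives of \<open>P\<close> and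
  \<open>Q\<close>, and the mixed terms cancel.\<close>

lemma levi_civita_warped:
  fixes U :: "'b::euclidean_space set" and P Q :: "real \<Rightarrow> real"
  assumes I: "open I" and U: "open U" and P: "smooth_on I P" and Q: "smooth_on I Q"
    and pos: "\<And>t. t \<in> I \<Longrightarrow> P t > 0" "\<And>t. t \<in> I \<Longrightarrow> Q t > 0"
    and g: "\<And>x v w. x \<in> I \<times> U \<Longrightarrow>
      g x v w = P (fst x) * (fst v * fst w) + Q (fst x) * (snd v \<bullet> snd w)"
  shows "levi_civita (I \<times> U) g (warped_conn P Q)"
proof -
  let ?M = "I \<times> U"
  note M = open_Times[OF I U]
  note D = smooth_on_has_derivative[where M = ?M]
  have smooth: "smooth_on ?M (warped_conn P Q X Y)" if X: "smooth_on ?M X" and Y: "smooth_on ?M Y" for X Y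
  proof -
    have "smooth_on ?M (\<lambda>x. frechet_derivative Y (at x) (X x) +
     (deriv P (fst x) / (2 * P (fst x)) * (fst (X x) * fst (Y x))
        + - (deriv Q (fst x) / (2 * P (fst x)) * (snd (X x) \<bullet> snd (Y x))),
      (deriv Q (fst x) / (2 * Q (fst x))) *\<^sub>R (fst (X x) *\<^sub>R snd (Y x) + fst (Y x) *\<^sub>R snd (X x))))"
      by (intro smooth_on_add smooth_on_Pair smooth_on_minus smooth_on_mult smooth_on_divide
          smooth_on_scaleR smooth_on_inner smooth_on_fst smooth_on_snd smooth_on_const
          smooth_on_derivative_along smooth_on_compose_fst smooth_on_deriv(1) I U M P Q X Y)
        (use pos in \<open>force+\<close>)
    then show ?thesis
      by (simp add: warped_conn_def[abs_def] christoffel_def)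
  qed
  have add: "frechet_derivative (\<lambda>y. Y y + Y' y) (at x) v
      = frechet_derivative Y (at x) v + frechet_derivative Y' (at x) v"
    if "smooth_on ?M Y" "smooth_on ?M Y'" "x \<in> ?M" for Y Y' :: "real \<times> 'b \<Rightarrow> real \<times> 'b" and x v
    by (rule fun_cong[OF frechet_derivative_at[symmetric]])
      (intro has_derivative_add D that)
  have scale: "frechet_derivative (\<lambda>y. f y *\<^sub>R Y y) (at x) v
      = frechet_derivative f (at x) v *\<^sub>R Y x + f x *\<^sub>R frechet_derivative Y (at x) v"
    if "smooth_on ?M f" "smooth_on ?M Y" "x \<in> ?M"
    for f :: "real \<times> 'b \<Rightarrow> real" and Y :: "real \<times> 'b \<Rightarrow> real \<times> 'b" and x v
    unfolding add.commute[of "_ *\<^sub>R Y x"]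
    by (rule fun_cong[OF frechet_derivative_at[symmetric]])
      (intro has_derivative_scaleR D that)
  have lin: "linear (frechet_derivative Y (at x))" if "smooth_on ?M Y" "x \<in> ?M"
    for Y :: "real \<times> 'b \<Rightarrow> real \<times> 'b" and x
    using smooth_on_linear_derivative[OF that] .
  have compat: "frechet_derivative (\<lambda>y. g y (Y y) (Z y)) (at x) (X x) =
      g x (warped_conn P Q X Y x) (Z x) + g x (Y x) (warped_conn P Q X Z x)"
    if Y: "smooth_on ?M Y" and Z: "smooth_on ?M Z" and x: "x \<in> ?M" for X Y Z x
  proof -
    have t: "fst x \<in> I"
      using x by auto
    have d: "((\<lambda>y. f (fst y)) has_derivative (\<lambda>v. deriv f (fst x) * fst v)) (at x)"
      if "smooth_on I f" for f
      by (rule has_derivative_fst_compose)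
        (rule smooth_on_deriv(2)[OF I that t, unfolded has_field_derivative_def])
    let ?dY = "frechet_derivative Y (at x)" and ?dZ = "frechet_derivative Z (at x)"
    have "((\<lambda>y. P (fst y) * (fst (Y y) * fst (Z y)) + Q (fst y) * (snd (Y y) \<bullet> snd (Z y))) has_derivative
      (\<lambda>v. (P (fst x) * (fst (Y x) * fst (?dZ v) + fst (?dY v) * fst (Z x))
          + deriv P (fst x) * fst v * (fst (Y x) * fst (Z x)))
        + (Q (fst x) * (snd (Y x) \<bullet> snd (?dZ v) + snd (?dY v) \<bullet> snd (Z x))
          + deriv Q (fst x) * fst v * (snd (Y x) \<bullet> snd (Z x))))) (at x)"
      by (intro derivative_intros d P Q D[OF Y x] D[OF Z x])
    then have "((\<lambda>y. g y (Y y) (Z y)) has_derivative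
      (\<lambda>v. (P (fst x) * (fst (Y x) * fst (?dZ v) + fst (?dY v) * fst (Z x))
          + deriv P (fst x) * fst v * (fst (Y x) * fst (Z x)))
        + (Q (fst x) * (snd (Y x) \<bullet> snd (?dZ v) + snd (?dY v) \<bullet> snd (Z x))
          + deriv Q (fst x) * fst v * (snd (Y x) \<bullet> snd (Z x))))) (at x)"
      by (rule has_derivative_transform_within_open[OF _ M x]) (simp add: g)
    from frechet_derivative_at[OF this, symmetric] show ?thesis
      using pos[OF t]
      by (simp add: g[OF x] warped_conn_def christoffel_def field_simps inner_add_left inner_add_right
          inner_commute)
  qed
  show ?thesis
    unfolding levi_civita_def affine_connection_def
    using smooth compat
    by (auto simp: warped_conn_def add scale christoffel_simps linear_add[OF lin] linear_scale[OF lin]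
        algebra_simps christoffel_commute[of P Q])
qed

text \<open>The complement of the axis is the horizontal space. An orthogonal matrix in an
  orthonormal basis preserves \<open>b\<close> there, where \<open>b\<close> is \<open>Q\<close>
  times the Euclidean product; hence \<open>g\<close> is the identity times an isometry.\<close>

lemma rotation_fixing_axis:
  fixes g :: "real \<times> 'b::euclidean_space \<Rightarrow> real \<times> 'b" and E :: "'m::finite \<Rightarrow> real \<times> 'b"
  assumes g: "linear g" "g (c, 0) = (c, 0)" and c: "c \<noteq> 0" and pos: "P > 0" "Q > 0"
    and b: "\<And>v w. b v w = P * (fst v * fst w) + Q * (snd v \<bullet> snd w)"
    and E: "orthonormal_basis_of_complement b (c, 0) E" "acts_by_rotation E g"
  obtains R where "linear R" "\<And>a w. g (a, w) = (a, R w)" "\<And>v w. R v \<bullet> R w = v \<bullet> w"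
proof -
  obtain A :: "real^'m^'m" where A: "rotation_matrix A"
    and gE: "\<And>j. g (E j) = (\<Sum>i\<in>UNIV. (A $ i $ j) *\<^sub>R E i)"
    using E(2) unfolding acts_by_rotation_def by blast
  have orth: "\<And>i j. b (E i) (E j) = (if i = j then 1 else 0)"
    and span: "span (range E) = {w. fst w = 0}"
    using E(1) c pos unfolding orthonormal_basis_of_complement_def b by auto
  have lin1: "linear (\<lambda>v. b v w)" and lin2: "linear (b w)" for w
    by (rule linearI; simp add: b algebra_simps inner_add_left inner_add_right)+
  have E0: "fst (E j) = 0" for j
    using span_base[of "E j" "range E"] unfolding span by blast
  have "transpose A ** A = mat 1"
    using A by (simp add: rotation_matrix_def orthogonal_matrix)
  then have AA: "(\<Sum>i\<in>UNIV. A $ i $ j * A $ i $ k) = (if j = k then 1 else 0)" for j k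
    by (simp add: vec_eq_iff matrix_matrix_mult_def transpose_def mat_def)
  have EE: "b (g (E j)) (g (E k)) = b (E j) (E k)" for j k
  proof -
    have "b (g (E j)) (g (E k)) = (\<Sum>i\<in>UNIV. A $ i $ j * b (E i) (g (E k)))"
      unfolding gE[of j] by (simp add: linear_sum[OF lin1] linear_scale[OF lin1])
    also have "\<dots> = (\<Sum>i\<in>UNIV. A $ i $ j * A $ i $ k)"
      unfolding gE[of k] by (simp add: linear_sum[OF lin2] linear_scale[OF lin2] orth if_distrib sum.delta cong: if_cong)
    finally show ?thesis
      by (simp add: AA orth)
  qed
  note lin = linear_compose[OF g(1) lin1, unfolded o_def] linear_compose[OF g(1) lin2, unfolded o_def]
  have iso: "b (g v) (g w) = b v w" if "v \<in> span (range E)" "w \<in> span (range E)" for v w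
  proof -
    have "b (g (E j)) (g w) = b (E j) w" for j
      by (rule linear_eq_on[OF lin(2) lin2 that(2)]) (auto simp: EE)
    then show ?thesis
      by (intro linear_eq_on[OF lin(1) lin1 that(1)]) auto
  qed
  have horiz: "fst (g v) = 0" if "v \<in> span (range E)" for v
  proof -
    have "(fst \<circ> g) w = 0" if "w \<in> range E" for w
      using that by (elim rangeE) (simp add: gE fst_sum E0)
    from linear_eq_on[OF linear_compose[OF g(1) linear_fst] linear_zero that this]
    show ?thesis
      by simp
  qed
  have in_span: "(0, w) \<in> span (range E)" for w
    by (simp add: span)
  \<comment> \<open>Rescaling the fixed unit vector shows that \<open>g\<close> fixes the whole
    axis.\<close>
  have "g (1, 0) = (1, 0)"
    using linear_scale[OF g(1), of "1 / c" "(c, 0)"] g(2) c by simp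
  show ?thesis
  proof
    show "linear (\<lambda>w. snd (g (0, w)))"
      by (rule linearI)
        (use linear_add[OF g(1), of "(0, _)" "(0, _)"] linear_scale[OF g(1), of _ "(0, _)"] in simp_all)
    show "g (a, w) = (a, snd (g (0, w)))" for a w
    proof -
      have "g (a, w) = a *\<^sub>R g (1, 0) + g (0, w)"
        using linear_add[OF g(1), of "(a, 0)" "(0, w)"] linear_scale[OF g(1), of a "(1, 0)"] by simp
      then show ?thesis
        using \<open>g (1, 0) = (1, 0)\<close> horiz[OF in_span[of w]] by (simp add: prod_eq_iff)
    qed
    show "snd (g (0, v)) \<bullet> snd (g (0, w)) = v \<bullet> w" for v w
      using iso[OF in_span[of v] in_span[of w]] horiz[OF in_span[of v]] pos(2) by (simp add: b)
  qed
qed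

section \<open>Affine metric, shape operator and difference tensor of the normal\<close>

context curve_graph
begin

lemma affine_normal_\<xi>\<^sub>0: "convex_affine_normal M F \<xi>\<^sub>0"
  by (simp add: convex_affine_normal_iff)

lemma second_form_\<xi>\<^sub>0:
  assumes "x \<in> M"
  shows "second_form F \<xi>\<^sub>0 x v w
    = D (fst x) / mu (fst x) * (fst v * fst w) + 1 / mu (fst x) * (snd v \<bullet> snd w)"
proof -
  have c: "conormal x (\<xi>\<^sub>0 x) = mu (fst x)"
    by (rule convex_affine_normal_imp_conormal(2)[OF affine_normal_\<xi>\<^sub>0 assms])
  have "mu (fst x) > 0"
    using mu_pos assms by auto
  with c show ?thesis
    using second_form_eq[where \<xi> = \<xi>\<^sub>0, OF assms] by (simp add: add_divide_distrib)
qed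

lemma convex: "convex_hypersurface M F"
  using affine_normal_\<xi>\<^sub>0 immersed
  unfolding convex_hypersurface_def convex_affine_normal_def affine_normal_def by blast

text \<open>The derivative of \<open>\<xi>\<^sub>0\<close> has conormal 0, so it is already
  tangential. It has no horizontal part, and its last component depends only on the
  \<open>t\<close>-part of the direction.\<close>

lemma shape_operator_\<xi>\<^sub>0:
  assumes x: "x \<in> M"
  obtains s where "\<And>v. shape_operator F \<xi>\<^sub>0 x v = (s * fst v, 0)"
proof -
  note c = convex_affine_normal_imp_conormal[OF affine_normal_\<xi>\<^sub>0]
  let ?d = "frechet_derivative \<xi>\<^sub>0 (at x)" and ?f = "\<lambda>t. nu t * deriv \<gamma>2 t"
  note \<xi> = smooth_on_has_derivative[OF c(1) x]
  have t: "fst x \<in> I" and nz: "conormal x (\<xi>\<^sub>0 x) \<noteq> 0"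
    using x c(2)[OF x] mu_pos[of "fst x"] by auto
  have "((\<lambda>y. horizontal (\<xi>\<^sub>0 y)) has_derivative (\<lambda>v. 0)) (at x)"
    by (rule has_derivative_transform_within_open[OF has_derivative_const open_M x])
      (simp add: normal_field_eq)
  then have h: "horizontal (?d v) = 0" for v
    using has_derivative_unique[OF bounded_linear.has_derivative[OF bounded_linear_horizontal \<xi>]]
    by (auto dest: fun_cong)
  have "(?f has_derivative (*) (deriv ?f (fst x))) (at (fst x))"
    using smooth_on_deriv(2)[OF open_I smooth_on_mult[OF open_I smooth_nu smooth_deriv_\<gamma>(2)] t]
    by (simp add: has_field_derivative_def)
  from has_derivative_fst_compose[OF this]
  have "((\<lambda>y. \<xi>\<^sub>0 y $ None) has_derivative (\<lambda>v. deriv ?f (fst x) * fst v)) (at x)"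
    by (rule has_derivative_transform_within_open[OF _ open_M x]) (simp add: normal_field_eq)
  then have n: "?d v $ None = deriv ?f (fst x) * fst v" for v
    using has_derivative_unique[OF bounded_linear.has_derivative[OF bounded_linear_vec_nth \<xi>]]
    by (auto dest: fun_cong)
  have "shape_operator F \<xi>\<^sub>0 x v = (- (deriv ?f (fst x) / deriv \<gamma>2 (fst x)) * fst v, 0)" for v
    by (simp add: shape_operator_def tangential_part_eq[where \<xi> = \<xi>\<^sub>0, OF x nz] c(3)[OF x]
        chart_def h n)
  with that show ?thesis
    by blast
qed

text \<open>Neither \<open>hess\<close> nor \<open>\<xi>\<^sub>0\<close> has a horizontal part, so
  on constant fields the induced connection points along the \<open>t\<close>-axis; all remaining
  terms come from \<open>christoffel\<close>.\<close>

lemma difference_tensor_\<xi>\<^sub>0: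
  assumes x: "x \<in> M"
  obtains p q r where "\<And>v w. difference_tensor F \<xi>\<^sub>0 (warped_conn P Q) x v w =
    (p * (fst v * fst w) + q * (snd v \<bullet> snd w), r *\<^sub>R (fst v *\<^sub>R snd w + fst w *\<^sub>R snd v))"
proof -
  have t: "fst x \<in> I" and nz: "conormal x (\<xi>\<^sub>0 x) \<noteq> 0"
    using x convex_affine_normal_imp_conormal(2)[OF affine_normal_\<xi>\<^sub>0 x] mu_pos[of "fst x"] by auto
  let ?t = "fst x" and ?c = "nu (fst x) / conormal x (\<xi>\<^sub>0 x)"
  let ?p = "deriv (deriv \<gamma>2) ?t / deriv \<gamma>2 ?t - D ?t * ?c - deriv P ?t / (2 * P ?t)"
  let ?q = "deriv Q ?t / (2 * P ?t) - ?c"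
  let ?r = "- (deriv Q ?t / (2 * Q ?t))"
  have "difference_tensor F \<xi>\<^sub>0 (warped_conn P Q) x v w =
    (?p * (fst v * fst w) + ?q * (snd v \<bullet> snd w), ?r *\<^sub>R (fst v *\<^sub>R snd w + fst w *\<^sub>R snd v))" for v w
  proof -
    have "chart x (hess x v w - ((D ?t * fst v * fst w + snd v \<bullet> snd w) / conormal x (\<xi>\<^sub>0 x)) *\<^sub>R \<xi>\<^sub>0 x)
      = ((deriv (deriv \<gamma>2) ?t / deriv \<gamma>2 ?t - D ?t * ?c) * (fst v * fst w) - ?c * (snd v \<bullet> snd w), 0)"
      using deriv_\<gamma>2_nonzero[OF t] nz
      by (simp add: chart_def hess_def normal_field_eq[OF x] field_simps)
    then show ?thesis
      unfolding difference_tensor_def induced_conn_const[where \<xi> = \<xi>\<^sub>0, OF x nz]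
      by (simp add: warped_conn_def christoffel_def algebra_simps)
  qed
  with that show ?thesis
    by blast
qed

text \<open>An admissible \<open>g\<close> has the form \<open>(a, w) \<mapsto> (a, R w)\<close>
  with \<open>R\<close> a linear isometry. The formulas for \<open>S\<close> and \<open>K\<close>
  use only the \<open>t\<close>-components, inner products and linear combinations of
  \<open>u\<close>-components, all compatible with \<open>R\<close>.\<close>

lemma symmetry: "pointwise_SO_symmetry M F"
proof -
  let ?P = "\<lambda>t. D t / mu t" and ?Q = "\<lambda>t. 1 / mu t"
  let ?h = "second_form F \<xi>\<^sub>0" and ?N = "warped_conn ?P ?Q"
  have pos: "?P t > 0" "?Q t > 0" if "t \<in> I" for t
    using that D_pos mu_pos by auto
  have lc: "levi_civita M ?h ?N"
  proof (rule levi_civita_warped[where P = ?P and Q = ?Q, OF open_I open_U _ _ pos])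
    have mu: "mu t \<noteq> 0" if "t \<in> I" for t
      using mu_pos[OF that] by simp
    show "?h x v w = ?P (fst x) * (fst v * fst w) + ?Q (fst x) * (snd v \<bullet> snd w)" if "x \<in> M" for x v w
      by (rule second_form_\<xi>\<^sub>0[OF that])
    show "smooth_on I ?P" "smooth_on I ?Q"
      by (intro smooth_on_divide smooth_D smooth_mu smooth_on_const open_I mu; assumption)+
  qed
  have "\<exists>X1. ?h x X1 X1 = 1 \<and>
         (\<forall>g. linear g \<and> bij g \<and> g X1 = X1 \<and>
              (\<exists>E :: 'm \<Rightarrow> real \<times> (real^'m). orthonormal_basis_of_complement (?h x) X1 E \<and>
                 acts_by_rotation E g) \<longrightarrow>
            (\<forall>X Y. shape_operator F \<xi>\<^sub>0 x (g X) = g (shape_operator F \<xi>\<^sub>0 x X) \<and>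
               difference_tensor F \<xi>\<^sub>0 ?N x (g X) (g Y) = g (difference_tensor F \<xi>\<^sub>0 ?N x X Y)))"
    if x: "x \<in> M" for x
  proof -
    have t: "fst x \<in> I"
      using x by auto
    \<comment> \<open>The distinguished vector is the coordinate vector of \<open>t\<close>, scaled
      to unit length for the affine metric.\<close>
    let ?c = "1 / sqrt (?P (fst x))"
    obtain s where s: "\<And>v. shape_operator F \<xi>\<^sub>0 x v = (s * fst v, 0)"
      using shape_operator_\<xi>\<^sub>0[OF x] by blast
    obtain p q r where K: "\<And>v w. difference_tensor F \<xi>\<^sub>0 ?N x v w =
        (p * (fst v * fst w) + q * (snd v \<bullet> snd w), r *\<^sub>R (fst v *\<^sub>R snd w + fst w *\<^sub>R snd v))"
      using difference_tensor_\<xi>\<^sub>0[OF x] by blast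
    have c: "?c \<noteq> 0"
      using D_pos[OF t] mu_pos[OF t] by simp
    have "?c * ?c = 1 / ?P (fst x)"
      using D_pos[OF t] mu_pos[OF t] by simp
    then have "?h x (?c, 0) (?c, 0) = 1"
      unfolding second_form_\<xi>\<^sub>0[OF x] using D_pos[OF t] mu_pos[OF t] by simp
    moreover have "shape_operator F \<xi>\<^sub>0 x (g X) = g (shape_operator F \<xi>\<^sub>0 x X) \<and>
        difference_tensor F \<xi>\<^sub>0 ?N x (g X) (g Y) = g (difference_tensor F \<xi>\<^sub>0 ?N x X Y)"
      if g: "linear g" "g (?c, 0) = (?c, 0)"
        and E: "orthonormal_basis_of_complement (?h x) (?c, 0) E" "acts_by_rotation E g"
      for g X Y and E :: "'m \<Rightarrow> real \<times> (real^'m)"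
    proof -
      obtain R where R: "linear R" "\<And>a w. g (a, w) = (a, R w)" "\<And>v w. R v \<bullet> R w = v \<bullet> w"
        using rotation_fixing_axis[OF g c pos[OF t] second_form_\<xi>\<^sub>0[OF x] E] by blast
      have "fst (g v) = fst v" "snd (g v) = R (snd v)" for v
        using R(2)[of "fst v" "snd v"] by auto
      then show ?thesis
        by (simp add: s K R linear_0[OF R(1)] linear_add[OF R(1)] linear_scale[OF R(1)])
    qed
    ultimately show ?thesis
      by blast
  qed
  then show ?thesis
    unfolding pointwise_SO_symmetry_def using affine_normal_\<xi>\<^sub>0 lc by blast
qed

section \<open>The equations for the coefficient functions\<close>

lemma normal_equations_mu_nu: "normal_equations I (CARD('m) + 1) \<gamma>1 \<gamma>2 mu nu"
proof -
  have "(mu has_real_derivative - nu t * (curve_det \<gamma>1 \<gamma>2 t / deriv \<gamma>2 t)) (at t)" if t: "t \<in> I" for t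
    using smooth_on_deriv(2)[OF open_I smooth_mu t] unfolding deriv_mu[OF t] unfolding D_def .
  \<comment> \<open>The sign is 1 for the positive root, because \<open>D\<close> times
    \<open>deriv \<gamma>2\<close> is \<open>curve_det\<close>.\<close>
  moreover have "mu t ^ (CARD('m) + 1 + 2) * deriv \<gamma>2 t ^ 3 = 1 * curve_det \<gamma>1 \<gamma>2 t" if t: "t \<in> I" for t
  proof -
    have "mu t ^ (CARD('m) + 1 + 2) * deriv \<gamma>2 t ^ 3 = D t / (deriv \<gamma>2 t)\<^sup>2 * deriv \<gamma>2 t ^ 3"
      using mu_power[OF t] by (simp add: numeral_3_eq_3)
    also have "\<dots> = curve_det \<gamma>1 \<gamma>2 t"
      using deriv_\<gamma>2_nonzero[OF t] by (simp add: D_def power2_eq_square power3_eq_cube)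
    finally show ?thesis
      by simp
  qed
  ultimately show ?thesis
    unfolding normal_equations_def by blast
qed

text \<open>The power equation fixes the absolute value of \<open>\<mu>'\<close>. A continuous
  function without zeros keeps its sign on an interval, and the differential equation then gives
  \<open>\<nu>'\<close>, since \<open>D\<close> is positive.\<close>

lemma normal_equations_unique:
  assumes I: "is_interval I" and eq: "normal_equations I (CARD('m) + 1) \<gamma>1 \<gamma>2 \<mu>' \<nu>'"
  shows "(\<forall>t\<in>I. \<mu>' t = mu t \<and> \<nu>' t = nu t) \<or> (\<forall>t\<in>I. \<mu>' t = - mu t \<and> \<nu>' t = - nu t)"
proof -
  obtain s :: real where s: "s \<in> {1, -1}"
    and p: "\<And>t. t \<in> I \<Longrightarrow> \<mu>' t ^ (CARD('m) + 1 + 2) * deriv \<gamma>2 t ^ 3 = s * curve_det \<gamma>1 \<gamma>2 t"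
    and d': "\<And>t. t \<in> I \<Longrightarrow> (\<mu>' has_real_derivative - \<nu>' t * D t) (at t)"
    using eq unfolding normal_equations_def D_def by blast
  have d: "(mu has_real_derivative - nu t * D t) (at t)" if t: "t \<in> I" for t
    using smooth_on_deriv(2)[OF open_I smooth_mu t] unfolding deriv_mu[OF t] .
  have abs: "\<bar>\<mu>' t\<bar> = mu t" if t: "t \<in> I" for t
  proof -
    have "\<mu>' t ^ (CARD('m) + 3) * deriv \<gamma>2 t ^ 3 = s * (D t * deriv \<gamma>2 t)"
      using p[OF t] deriv_\<gamma>2_nonzero[OF t] by (simp add: D_def numeral_3_eq_3)
    then have "\<mu>' t ^ (CARD('m) + 3) = s * (D t / (deriv \<gamma>2 t)\<^sup>2)"
      using deriv_\<gamma>2_nonzero[OF t] by (simp add: field_simps power2_eq_square power3_eq_cube)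
    \<comment> \<open>Absolute values treat even and odd n+2, and both values of \<open>s\<close>,
      at once.\<close>
    then have "\<bar>\<mu>' t\<bar> ^ (CARD('m) + 3) = \<bar>s\<bar> * \<bar>D t / (deriv \<gamma>2 t)\<^sup>2\<bar>"
      by (simp only: power_abs[symmetric] abs_mult)
    also have "\<dots> = mu t ^ (CARD('m) + 3)"
      using s mu_power[OF t] D_pos[OF t] by auto
    finally show ?thesis
      by (rule power_eq_imp_eq_base) (use mu_pos[OF t] in auto)
  qed
  have cont: "continuous_on I \<mu>'"
    using d' DERIV_isCont by (intro continuous_at_imp_continuous_on) blast
  have nz: "\<mu>' t \<noteq> 0" if "t \<in> I" for t
    using abs[OF that] mu_pos[OF that] by auto
  have "(\<forall>t\<in>I. \<mu>' t > 0) \<or> (\<forall>t\<in>I. \<mu>' t < 0)"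
  proof (rule ccontr)
    assume "\<not> ?thesis"
    then obtain a b where ab: "a \<in> I" "b \<in> I" "\<mu>' a \<le> 0" "\<mu>' b \<ge> 0"
      by (meson not_le)
    have "is_interval (\<mu>' ` I)"
      using connected_continuous_image[OF cont] I by (simp add: is_interval_connected_1)
    \<comment> \<open>The image of \<open>I\<close> is an interval containing a nonpositive and a
      nonnegative value.\<close>
    then have "0 \<in> \<mu>' ` I"
      using ab unfolding is_interval_1 by blast
    then show False
      using nz by auto
  qed
  then obtain \<sigma> :: real where \<sigma>: "\<sigma> = 1 \<or> \<sigma> = -1" and mu': "\<And>t. t \<in> I \<Longrightarrow> \<mu>' t = \<sigma> * mu t"
  proof
    assume "\<forall>t\<in>I. \<mu>' t > 0"
    with abs show ?thesis
      by (intro that[of 1]) fastforce+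
  next
    assume "\<forall>t\<in>I. \<mu>' t < 0"
    with abs show ?thesis
      by (intro that[of "-1"]) fastforce+
  qed
  have "\<nu>' t = \<sigma> * nu t" if t: "t \<in> I" for t
  proof -
    have "(\<mu>' has_real_derivative \<sigma> * (- nu t * D t)) (at t)"
      by (rule has_field_derivative_transform_within_open[OF DERIV_cmult[OF d[OF t]] open_I t])
        (simp add: mu')
    from DERIV_unique[OF d'[OF t] this] show ?thesis
      using D_pos[OF t] by simp
  qed
  with \<sigma> mu' show ?thesis
    by auto
qed

end

text \<open>The choice of sign is expressed by stating that the equations determine the pair of
  functions up to a common sign. The witness is the pair with positive \<open>\<mu>\<close>, for
  which \<open>h\<close> is positive definite.\<close>

theorem theorem3p4:
  fixes n :: nat and I :: "real set" and U :: "(real^'m::finite) set"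
    and \<gamma>1 \<gamma>2 :: "real \<Rightarrow> real"
  assumes "n = CARD('m) + 1" and "n \<ge> 3"
    and "open I" and "is_interval I" and "open U"
    and "smooth_on I \<gamma>1" and "smooth_on I \<gamma>2"
    and "\<And>t. t \<in> I \<Longrightarrow> curve_det \<gamma>1 \<gamma>2 t * deriv \<gamma>2 t > 0"
  shows "convex_hypersurface (I \<times> U) (F_map \<gamma>1 \<gamma>2) \<and>
    pointwise_SO_symmetry (I \<times> U) (F_map \<gamma>1 \<gamma>2) \<and>
    (\<exists>\<mu> \<nu>. smooth_on I \<mu> \<and> smooth_on I \<nu> \<and> normal_equations I n \<gamma>1 \<gamma>2 \<mu> \<nu> \<and>
      (\<forall>\<xi>. convex_affine_normal (I \<times> U) (F_map \<gamma>1 \<gamma>2) \<xi> \<longleftrightarrow>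
           (\<forall>x\<in>I \<times> U. \<xi> x = normal_field \<gamma>1 \<gamma>2 \<mu> \<nu> x)) \<and>
      (\<forall>\<mu>' \<nu>'. normal_equations I n \<gamma>1 \<gamma>2 \<mu>' \<nu>' \<longrightarrow>
           (\<forall>t\<in>I. \<mu>' t = \<mu> t \<and> \<nu>' t = \<nu> t) \<or> (\<forall>t\<in>I. \<mu>' t = - \<mu> t \<and> \<nu>' t = - \<nu> t)))"
proof -
  interpret curve_graph I U \<gamma>1 \<gamma>2
    by unfold_locales (fact assms)+
  show ?thesis
    unfolding \<open>n = CARD('m) + 1\<close>
    using convex symmetry smooth_mu smooth_nu normal_equations_mu_nu convex_affine_normal_iff
      normal_equations_unique[OF \<open>is_interval I\<close>]
    by blast
qed

end
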